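(* Let $k \ge 2$ be a fixed integer, and for each $n \ge 1$ let $S_n$ be the length of the shortest path from node $n$ to the root $0$ in the uniform random $k$-dag. Let $\sigma$ be the solution $x \in (0,1)$ of $$\varphi(x) = 1, \qquad \text{where } \varphi(x) = \left( \frac{ke}{x} \right)^x e^{-1}$$ (the function $\varphi$ is increasing on $(0,1)$). Then, as $n \to \infty$, $$\frac{S_n}{\log n} \to \sigma \quad \text{in probability} \qquad \text{and} \qquad \frac{\max_{1 \le \ell \le n} S_\ell}{\log n} \to \sigma \quad \text{in probability}.$$
   Context: The uniform random $k$-dag is the infinite random directed acyclic graph on the non-negative integers defined as follows: node $0$ is the root, and each node $m = 1, 2, \ldots$ independently chooses $k$ parents, independently and uniformly with replacement from $\{0, 1, \ldots, m-1\}$; there is a directed edge from $m$ to each of its parents. For a node $n$, let $\mathcal{P}_n$ be the collection of all directed paths from $n$ to $0$ (each step going from a node to one of its parents), let $L(p)$ be the length (number of edges) of a path $p$, and let $S_n = \min_{p \in \mathcal{P}_n} L(p)$. Here $\log$ is the natural logarithm. *)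

theory Defs
  imports "HOL-Probability.Probability" "Graph_Theory.Arc_Walk"
begin

text \<open>
  The \<open>k\<close>-dag determined by a table of parents: \<open>par (m, j)\<close> is the \<open>j\<close>-th parent of node \<open>m\<close>.
  Parents are chosen with replacement, so there may be parallel edges; the edges are therefore
  the pairs \<open>(m, j)\<close> themselves. The root \<open>0\<close> has no outgoing edge.
\<close>

definition dag_edges :: "nat \<Rightarrow> (nat \<times> nat) set" where
  "dag_edges k = {1..} \<times> {..<k}"

definition dag :: "nat \<Rightarrow> (nat \<times> nat \<Rightarrow> nat) \<Rightarrow> (nat, nat \<times> nat) pre_digraph" where
  "dag k par = \<lparr>verts = UNIV, arcs = dag_edges k, tail = fst, head = par\<rparr>"

definition paths_to_root :: "nat \<Rightarrow> (nat \<times> nat \<Rightarrow> nat) \<Rightarrow> nat \<Rightarrow> (nat \<times> nat) list set" where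
  "paths_to_root k par n = {p. pre_digraph.apath (dag k par) n p 0}"

text \<open>A path is the list of its edges, so \<open>length\<close> counts edges.\<close>

definition shortest_path_length :: "nat \<Rightarrow> (nat \<times> nat \<Rightarrow> nat) \<Rightarrow> nat \<Rightarrow> nat" where
  "shortest_path_length k par n = (INF p\<in>paths_to_root k par n. length p)"

locale uniform_random_dag = prob_space M for M :: "'w measure" +
  fixes k :: nat and parent :: "nat \<times> nat \<Rightarrow> 'w \<Rightarrow> nat"
  assumes indep_parents:
    "indep_vars (\<lambda>(m, j). count_space {..<m}) parent (dag_edges k)"
  and uniform_parents:
    "\<And>m j. (m, j) \<in> dag_edges k \<Longrightarrow>
      distr M (count_space {..<m}) (parent (m, j)) = uniform_count_measure {..<m}"
begin

definition S :: "nat \<Rightarrow> 'w \<Rightarrow> nat" where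
  "S n \<omega> = shortest_path_length k (\<lambda>e. parent e \<omega>) n"

lemma parent_less:
  assumes "(m, j) \<in> dag_edges k" "\<omega> \<in> space M"
  shows "parent (m, j) \<omega> < m"
proof -
  have "parent (m, j) \<in> measurable M (count_space {..<m})"
    using indep_parents assms(1) unfolding indep_vars_def2 by fastforce
  from measurable_space[OF this assms(2)] show ?thesis by simp
qed

end

text \<open>
  The infimum over paths is attained: if every parent is smaller than its child, then every node
  has a path to the root.
\<close>

lemma paths_to_root_nonempty:
  assumes less: "\<And>m j. (m, j) \<in> dag_edges k \<Longrightarrow> par (m, j) < m" and k: "0 < k"
  shows "paths_to_root k par n \<noteq> {}"
proof -
  interpret wf_digraph "dag k par" by unfold_locales (auto simp: dag_def)
  have [simp]: "arcs (dag k par) = dag_edges k" "tail (dag k par) = fst" "head (dag k par) = par"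
    by (simp_all add: dag_def)
  have "\<exists>p. apath n p 0 \<and> (\<forall>v \<in> set (awalk_verts n p). v \<le> n)"
  proof (induction n rule: less_induct)
    case (less n)
    show ?case
    proof (cases "n = 0")
      case True
      have "0 \<in> verts (dag k par)" by (simp add: dag_def)
      with True show ?thesis by (intro exI[of _ "[]"]) (simp add: apath_Nil_iff)
    next
      case False
      then have e: "(n, 0) \<in> dag_edges k" using k by (auto simp: dag_edges_def)
      then have lt: "par (n, 0) < n" by (rule assms(1))
      from less.IH[OF lt] obtain p where p: "apath (par (n, 0)) p 0"
        "\<forall>v \<in> set (awalk_verts (par (n, 0)) p). v \<le> par (n, 0)" by blast
      have "apath n ((n, 0) # p) 0"
        unfolding apath_Cons_iff using p e lt by auto
      moreover have "\<forall>v \<in> set (awalk_verts n ((n, 0) # p)). v \<le> n"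
        using p(2) lt by force
      ultimately show ?thesis by blast
    qed
  qed
  then show ?thesis by (auto simp: paths_to_root_def)
qed

text \<open>The uniform random \<open>k\<close>-dag exists, as the coordinate process on a product space.\<close>

lemma uniform_random_dag_exists:
  "uniform_random_dag
    (\<Pi>\<^sub>M e\<in>dag_edges k. uniform_count_measure {..<fst e}) k (\<lambda>e \<omega>. \<omega> e)"
proof -
  let ?N = "\<lambda>e :: nat \<times> nat. uniform_count_measure (if e \<in> dag_edges k then {..<fst e} else {0})"
  let ?P = "\<Pi>\<^sub>M e\<in>dag_edges k. ?N e"
  have N: "prob_space (?N e)" for e
    by (rule prob_space_uniform_count_measure) (auto simp: dag_edges_def lessThan_empty_iff)
  interpret product_prob_space ?N "dag_edges k"
    using N by (intro product_prob_spaceI)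
  have eq: "?P = (\<Pi>\<^sub>M e\<in>dag_edges k. uniform_count_measure {..<fst e})"
    by (rule PiM_cong) auto
  have meas: "(\<lambda>\<omega>. \<omega> e) \<in> measurable ?P (count_space {..<fst e})" if "e \<in> dag_edges k" for e
  proof -
    have "(\<lambda>\<omega>. \<omega> e) \<in> measurable ?P (?N e)" using that by (rule measurable_component_singleton)
    also have "measurable ?P (?N e) = measurable ?P (count_space {..<fst e})"
      using that by (intro measurable_cong_sets) (auto simp: sets_uniform_count_measure)
    finally show ?thesis .
  qed
  have distr: "distr ?P (count_space {..<fst e}) (\<lambda>\<omega>. \<omega> e) = uniform_count_measure {..<fst e}"
    if "e \<in> dag_edges k" for e
  proof -
    have "distr ?P (count_space {..<fst e}) (\<lambda>\<omega>. \<omega> e) = distr ?P (?N e) (\<lambda>\<omega>. \<omega> e)"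
      using that by (intro distr_cong) (auto simp: sets_uniform_count_measure)
    also have "\<dots> = ?N e" using that by (rule PiM_component)
    finally show ?thesis using that by simp
  qed
  have indep: "P.indep_vars (\<lambda>(m, j). count_space {..<m}) (\<lambda>e \<omega>. \<omega> e) (dag_edges k)"
  proof (cases "dag_edges k = {}")
    case True
    then show ?thesis unfolding P.indep_vars_def2 P.indep_sets_def by auto
  next
    case False
    have c: "(\<lambda>(m, j). count_space {..<m}) = (\<lambda>e :: nat \<times> nat. count_space {..<fst e})"
      by (auto simp: fun_eq_iff)
    have "distr ?P (\<Pi>\<^sub>M e\<in>dag_edges k. count_space {..<fst e}) (\<lambda>\<omega>. \<lambda>e\<in>dag_edges k. \<omega> e)
        = distr ?P ?P (\<lambda>\<omega>. \<omega>)"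
      by (intro distr_cong refl sets_PiM_cong)
         (auto simp: sets_uniform_count_measure space_PiM PiE_restrict)
    also have "\<dots> = ?P" by (rule distr_id)
    also have "\<dots> = (\<Pi>\<^sub>M e\<in>dag_edges k. distr ?P (count_space {..<fst e}) (\<lambda>\<omega>. \<omega> e))"
      by (rule PiM_cong) (auto simp: distr)
    finally show ?thesis
      unfolding c using False meas by (subst P.indep_vars_iff_distr_eq_PiM') auto
  qed
  have "uniform_random_dag ?P k (\<lambda>e \<omega>. \<omega> e)"
    using indep distr by unfold_locales force+
  then show ?thesis unfolding eq .
qed

definition tendsto_in_probability ::
    "'w measure \<Rightarrow> (nat \<Rightarrow> 'w \<Rightarrow> real) \<Rightarrow> real \<Rightarrow> bool" where
  "tendsto_in_probability M X c \<longleftrightarrow>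
    (\<forall>n. X n \<in> borel_measurable M) \<and>
    (\<forall>\<epsilon>>0. (\<lambda>n. measure M {\<omega> \<in> space M. \<bar>X n \<omega> - c\<bar> > \<epsilon>}) \<longlonglongrightarrow> 0)"

definition dag_phi :: "nat \<Rightarrow> real \<Rightarrow> real" where
  "dag_phi k x = (real k * exp 1 / x) powr x * exp (- 1)"

definition dag_sigma :: "nat \<Rightarrow> real" where
  "dag_sigma k = (THE x. x \<in> {0<..<1} \<and> dag_phi k x = 1)"

end

theory Submission
  imports Defs "HOL-Real_Asymp.Real_Asymp"
begin

text \<open>
  Let \<open>X\<^sub>t(l)\<close> be the fraction of the nodes \<open>i < l\<close> with \<open>S\<^sub>i > t\<close>. The root is at distance
  more than \<open>t + 1\<close> from \<open>l > 0\<close> exactly if it is at distance more than \<open>t\<close> from all \<open>k\<close> parents of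
  \<open>l\<close>, and these are independent and uniform below \<open>l\<close>. So, given all choices made below \<open>l\<close>, the
  event \<open>S\<^sub>l > t + 1\<close> has probability \<open>X\<^sub>t(l)^k\<close> (\<open>expectation_far_step\<close>). All
  probabilistic estimates are consequences of this identity. In it \<open>log l\<close> plays the role of space
  and \<open>t\<close> the role of time, and it describes a front that travels at speed \<open>1 / \<sigma>\<close>.

  Lower bound. As \<open>1 - (1 - z)^k \<le> k z\<close>, the probabilities \<open>P(S\<^sub>l \<le> t)\<close> are dominated by every
  positive solution of the linearised recursion that dominates them at \<open>t = 0\<close>. It has the explicit
  solutions \<open>(k / a)^t \<Gamma>(l + a) / (\<Gamma>(a) l!)\<close>, of order \<open>(k / a)^t l^(a - 1)\<close>, and for
  \<open>t = x log n\<close> the choice \<open>a = x\<close> bounds \<open>P(S\<^sub>n \<le> x log n)\<close> by \<open>n^(log \<phi>(x))\<close>, which tends to \<open>0\<close>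
  if \<open>x < \<sigma>\<close> (\<open>prob_near_le\<close>, \<open>near_early_tendsto_0\<close>).

  Upper bound, for all nodes up to \<open>n\<close> at once. An exponential supermartingale in the node \<open>l\<close> shows
  that, with high probability, \<open>l X\<^sub>t\<^sub>+\<^sub>1(l) \<le> (1 + s) \<Sum>\<^sub>i\<^sub><\<^sub>l X\<^sub>t(i)^k + O(log n)\<close> for all \<open>l \<le> n\<close>
  and all \<open>t < n\<close> (\<open>prob_far_count_gt\<close>). The rest consists of four stages, of which
  the second and the third are deterministic.
  \<^item> The nodes up to \<open>m = n^h\<close>, with \<open>h\<close> small, are within \<open>6 h log n\<close> of the root: the distance is at
    most the depth in a random recursive tree, whose exponential moments are explicit
    (\<open>prob_far_le\<close>).
  \<^item> While the fraction \<open>1 - X\<close> of near nodes is small, it is multiplied by almost \<open>k\<close> and averaged in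
    each step, as is the expected number of particles in a branching random walk with exponential
    displacements. If \<open>\<phi>(x) > 1\<close>, then \<open>r\<close> steps carry a given small fraction of near nodes from the
    range up to \<open>A\<close> to the range up to \<open>A e^(r / x)\<close>. So about \<open>x log n\<close> steps suffice to reach \<open>n\<close>
    (\<open>front_profile\<close>, \<open>front_reaches\<close>).
  \<^item> Once the near nodes have positive density everywhere, \<open>X\<close> is squared in each step; it drops
    doubly exponentially, down to the noise \<open>O(log n) / l\<close> (\<open>collapse\<close>).
  \<^item> One more step leaves no far node at all, because the expected number of far nodes above \<open>m\<close> is
    then at most \<open>\<Sum>\<^sub>l\<^sub>>\<^sub>m X(l)^k\<close>, which is \<open>o(1)\<close> (\<open>prob_exists_far_le\<close>).
\<close>

section \<open>Nodes within a given distance of the root\<close>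

text \<open>
  The relation \<open>S\<^sub>l \<le> t\<close>, by recursion on \<open>t\<close> instead of \<open>l\<close>, which terminates for every table of
  parents, also for one that is specified only up to some node and arbitrary beyond.
\<close>

primrec near :: "nat \<Rightarrow> (nat \<times> nat \<Rightarrow> nat) \<Rightarrow> nat \<Rightarrow> nat \<Rightarrow> bool" where
  "near k par 0 l \<longleftrightarrow> l = 0"
| "near k par (Suc t) l \<longleftrightarrow> l = 0 \<or> (\<exists>j<k. near k par t (par (l, j)))"

definition far_count :: "nat \<Rightarrow> (nat \<times> nat \<Rightarrow> nat) \<Rightarrow> nat \<Rightarrow> nat \<Rightarrow> nat" where
  "far_count k par t l = card {i \<in> {..<l}. \<not> near k par t i}"

definition far_frac :: "nat \<Rightarrow> (nat \<times> nat \<Rightarrow> nat) \<Rightarrow> nat \<Rightarrow> nat \<Rightarrow> real" where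
  "far_frac k par t l = real (far_count k par t l) / real l"

lemma near_root [simp]: "near k par t 0"
  by (cases t) auto

lemma near_Suc_mono: "near k par t l \<Longrightarrow> near k par (Suc t) l"
  by (induction t arbitrary: l) auto

lemma near_mono: "t \<le> t' \<Longrightarrow> near k par t l \<Longrightarrow> near k par t' l"
  by (induction t' rule: dec_induct) (auto simp del: near.simps intro: near_Suc_mono)

text \<open>
  Only the edges out of nodes below \<open>n\<close> matter for a node below \<open>n\<close>, since its paths to the root
  descend. So these distances are functions of the choices made below \<open>n\<close>, and independent of the later ones.
\<close>

lemma near_cong:
  assumes "\<And>m j. 1 \<le> m \<Longrightarrow> m < n \<Longrightarrow> j < k \<Longrightarrow> par' (m, j) = par (m, j)"
    and "\<And>m j. 1 \<le> m \<Longrightarrow> m < n \<Longrightarrow> j < k \<Longrightarrow> par (m, j) < m"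
    and "l < n"
  shows "near k par' t l \<longleftrightarrow> near k par t l"
  using assms(3)
proof (induction t arbitrary: l)
  case (Suc t)
  show ?case
  proof (cases "l = 0")
    case False
    have "near k par' t (par' (l, j)) \<longleftrightarrow> near k par t (par (l, j))" if "j < k" for j
      using Suc.IH[of "par (l, j)"] assms(1,2)[of l j] Suc.prems False that by fastforce
    then show ?thesis by auto
  qed auto
qed auto

text \<open>
  Every directed path to the root witnesses \<open>near\<close>; conversely, a walk that follows \<open>near\<close> strictly
  descends, so it visits no node twice and is a path.
\<close>

lemma near_iff_shortest_path:
  assumes less: "\<And>m j. (m, j) \<in> dag_edges k \<Longrightarrow> par (m, j) < m" and k: "0 < k"
  shows "shortest_path_length k par n \<le> t \<longleftrightarrow> near k par t n"
proof -
  interpret wf_digraph "dag k par" by unfold_locales (auto simp: dag_def)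
  have [simp]: "verts (dag k par) = UNIV" "arcs (dag k par) = dag_edges k"
    "tail (dag k par) = fst" "head (dag k par) = par"
    by (simp_all add: dag_def)
  have near_length: "near k par (length p) n" if "apath n p 0" for p n
    using that
  proof (induction p arbitrary: n)
    case (Cons e p)
    then obtain j where "e = (n, j)" "(n, j) \<in> dag_edges k" "apath (par (n, j)) p 0"
      unfolding apath_Cons_iff by (cases e) auto
    then show ?case using Cons.IH[of "par (n, j)"] by (auto simp: dag_edges_def)
  qed (auto simp: apath_Nil_iff)
  have path: "\<exists>p. apath n p 0 \<and> length p \<le> t \<and> (\<forall>v \<in> set (awalk_verts n p). v \<le> n)"
    if "near k par t n" for n
    using that
  proof (induction t arbitrary: n)
    case 0
    then show ?case by (intro exI[of _ "[]"]) (auto simp: apath_Nil_iff)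
  next
    case (Suc t)
    show ?case
    proof (cases "n = 0")
      case True
      then show ?thesis by (intro exI[of _ "[]"]) (auto simp: apath_Nil_iff)
    next
      case False
      then obtain j where j: "j < k" "near k par t (par (n, j))" using Suc.prems by auto
      then have e: "(n, j) \<in> dag_edges k" using False by (auto simp: dag_edges_def)
      from Suc.IH[OF j(2)] obtain p where p: "apath (par (n, j)) p 0" "length p \<le> t"
        "\<forall>v \<in> set (awalk_verts (par (n, j)) p). v \<le> par (n, j)" by blast
      have "apath n ((n, j) # p) 0"
        unfolding apath_Cons_iff using p less[OF e] e by auto
      moreover have "\<forall>v \<in> set (awalk_verts n ((n, j) # p)). v \<le> n"
        using p(3) less[OF e] by force
      ultimately show ?thesis using p(2)
        by (intro exI[of _ "(n, j) # p"]) auto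
    qed
  qed
  have ne: "paths_to_root k par n \<noteq> {}"
    using less k by (rule paths_to_root_nonempty)
  show ?thesis
  proof
    assume le: "shortest_path_length k par n \<le> t"
    have "shortest_path_length k par n \<in> length ` paths_to_root k par n"
      unfolding shortest_path_length_def using ne by (intro Inf_nat_def1) auto
    then obtain p where "apath n p 0" "length p \<le> t"
      using le by (auto simp: paths_to_root_def)
    then show "near k par t n" using near_length near_mono by blast
  next
    assume "near k par t n"
    then obtain p where p: "apath n p 0" "length p \<le> t" using path by blast
    have "shortest_path_length k par n \<le> length p"
      unfolding shortest_path_length_def using p(1) by (intro cInf_lower) (auto simp: paths_to_root_def)
    then show "shortest_path_length k par n \<le> t" using p(2) by simp
  qed
qed

lemma far_count_le: "far_count k par t l \<le> l"
  unfolding far_count_def by (rule order_trans[OF card_mono[of "{..<l}"]]) auto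

lemma far_count_0 [simp]: "far_count k par t 0 = 0"
  by (simp add: far_count_def)

lemma far_count_Suc:
  "far_count k par t (Suc l) = far_count k par t l + of_bool (\<not> near k par t l)"
proof -
  have "{i \<in> {..<Suc l}. \<not> near k par t i} =
      (if near k par t l then {i \<in> {..<l}. \<not> near k par t i}
       else insert l {i \<in> {..<l}. \<not> near k par t i})"
    by (auto simp: less_Suc_eq)
  then show ?thesis by (auto simp: far_count_def)
qed

lemma far_count_mono: "t \<le> t' \<Longrightarrow> far_count k par t' l \<le> far_count k par t l"
  unfolding far_count_def by (intro card_mono) (auto intro: near_mono)

lemma far_frac_nonneg [simp]: "0 \<le> far_frac k par t l"
  by (simp add: far_frac_def)

lemma far_frac_le_1: "far_frac k par t l \<le> 1"
  using far_count_le[of k par t l] by (auto simp: far_frac_def divide_simps)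

lemma far_frac_0 [simp]: "far_frac k par t 0 = 0"
  by (simp add: far_frac_def)

lemma far_frac_mono: "t \<le> t' \<Longrightarrow> far_frac k par t' l \<le> far_frac k par t l"
  using far_count_mono[of t t' k par l] by (simp add: far_frac_def divide_right_mono)

lemma far_frac_eq_0:
  assumes "\<And>i. i < l \<Longrightarrow> near k par t i"
  shows "far_frac k par t l = 0"
proof -
  have "{i \<in> {..<l}. \<not> near k par t i} = {}" using assms by auto
  then show ?thesis by (simp add: far_frac_def far_count_def)
qed

lemma far_frac_cong:
  assumes "\<And>m j. 1 \<le> m \<Longrightarrow> m < n \<Longrightarrow> j < k \<Longrightarrow> par' (m, j) = par (m, j)"
    and "\<And>m j. 1 \<le> m \<Longrightarrow> m < n \<Longrightarrow> j < k \<Longrightarrow> par (m, j) < m"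
    and "l \<le> n"
  shows "far_count k par' t l = far_count k par t l"
    and "far_frac k par' t l = far_frac k par t l"
proof -
  have "near k par' t i \<longleftrightarrow> near k par t i" if "i < l" for i
    using assms that by (intro near_cong[of n]) auto
  then show c: "far_count k par' t l = far_count k par t l"
    unfolding far_count_def by (intro arg_cong[where f = card]) auto
  show "far_frac k par' t l = far_frac k par t l" unfolding far_frac_def c ..
qed

section \<open>One node at a time\<close>

context uniform_random_dag
begin

abbreviation parents :: "'w \<Rightarrow> nat \<times> nat \<Rightarrow> nat" where
  "parents \<omega> \<equiv> \<lambda>e. parent e \<omega>"

definition edges_below :: "nat \<Rightarrow> (nat \<times> nat) set" where
  "edges_below l = {1..<l} \<times> {..<k}"

text \<open>
  The choices of all nodes below \<open>l\<close>. This random table has finitely many values, so functions of it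
  are simple random variables, and conditioning on it is a finite sum.
\<close>

definition hist :: "nat \<Rightarrow> 'w \<Rightarrow> nat \<times> nat \<Rightarrow> nat" where
  "hist l \<omega> = restrict (parents \<omega>) (edges_below l)"

definition hists :: "nat \<Rightarrow> (nat \<times> nat \<Rightarrow> nat) set" where
  "hists l = (\<Pi>\<^sub>E e\<in>edges_below l. {..<fst e})"

lemma finite_edges_below [simp]: "finite (edges_below l)"
  by (simp add: edges_below_def)

lemma edges_below_subset: "edges_below l \<subseteq> dag_edges k"
  by (auto simp: edges_below_def dag_edges_def)

lemma finite_hists [simp]: "finite (hists l)"
  unfolding hists_def by (intro finite_PiE) auto

lemma hist_in_hists: "\<omega> \<in> space M \<Longrightarrow> hist l \<omega> \<in> hists l"
  unfolding hists_def hist_def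
  using edges_below_subset parent_less by (fastforce simp: PiE_def)

lemma prob_parents:
  assumes "finite J" "J \<subseteq> dag_edges k" "\<And>e. e \<in> J \<Longrightarrow> A e \<subseteq> {..<fst e}"
  shows "{\<omega> \<in> space M. \<forall>e\<in>J. parent e \<omega> \<in> A e} \<in> events"
    and "prob {\<omega> \<in> space M. \<forall>e\<in>J. parent e \<omega> \<in> A e} = (\<Prod>e\<in>J. real (card (A e)) / real (fst e))"
proof -
  have meas: "parent e \<in> measurable M (count_space {..<fst e})" if "e \<in> dag_edges k" for e
    using indep_parents that unfolding indep_vars_def2 by (cases e) fastforce
  have one: "prob (parent e -` A e \<inter> space M) = real (card (A e)) / real (fst e)" if "e \<in> J" for e
  proof -
    have e: "e \<in> dag_edges k" "(fst e, snd e) \<in> dag_edges k" using that assms(2) by auto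
    have "prob (parent e -` A e \<inter> space M) = measure (distr M (count_space {..<fst e}) (parent e)) (A e)"
      using meas[OF e(1)] assms(3)[OF that] by (intro measure_distr[symmetric]) auto
    also have "\<dots> = measure (uniform_count_measure {..<fst e}) (A e)"
      using uniform_parents[OF e(2)] by simp
    also have "\<dots> = real (card (A e)) / real (card {..<fst e})"
      using assms(3)[OF that] by (intro measure_uniform_count_measure) auto
    finally show ?thesis by simp
  qed
  have eq: "{\<omega> \<in> space M. \<forall>e\<in>J. parent e \<omega> \<in> A e} = (\<Inter>e\<in>J. parent e -` A e \<inter> space M)" if "J \<noteq> {}"
    using that by auto
  have ev: "parent e -` A e \<inter> space M \<in> events" if "e \<in> J" for e
    using that assms(2,3) by (intro measurable_sets[OF meas]) auto
  show "{\<omega> \<in> space M. \<forall>e\<in>J. parent e \<omega> \<in> A e} \<in> events"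
  proof (cases "J = {}")
    case False
    show ?thesis unfolding eq[OF False] using False assms(1) ev by (intro sets.finite_INT) auto
  qed auto
  show "prob {\<omega> \<in> space M. \<forall>e\<in>J. parent e \<omega> \<in> A e} = (\<Prod>e\<in>J. real (card (A e)) / real (fst e))"
  proof (cases "J = {}")
    case False
    have "prob (\<Inter>e\<in>J. parent e -` A e \<inter> space M) = (\<Prod>e\<in>J. prob (parent e -` A e \<inter> space M))"
      using False assms(1,2)
    proof (intro indep_varsD[OF indep_parents])
      show "A e \<in> sets (case e of (m, j) \<Rightarrow> count_space {..<m})" if "e \<in> J" for e
        using assms(3)[OF that] by (cases e) auto
    qed
    then show ?thesis unfolding eq[OF False] using one by simp
  qed (simp add: prob_space)
qed

lemma hist_eq_event:
  assumes "h \<in> hists l"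
  shows "{\<omega> \<in> space M. hist l \<omega> = h} = {\<omega> \<in> space M. \<forall>e\<in>edges_below l. parent e \<omega> \<in> {h e}}"
proof -
  have "hist l \<omega> = h \<longleftrightarrow> (\<forall>e\<in>edges_below l. parent e \<omega> = h e)" for \<omega>
    using assms unfolding hist_def hists_def by (auto simp: PiE_def extensional_def restrict_def)
  then show ?thesis by auto
qed

lemma prob_hist_eq:
  assumes "h \<in> hists l"
  shows "{\<omega> \<in> space M. hist l \<omega> = h} \<in> events"
    and "prob {\<omega> \<in> space M. hist l \<omega> = h} = (\<Prod>e\<in>edges_below l. real (card {h e}) / real (fst e))"
proof -
  have "{h e} \<subseteq> {..<fst e}" if "e \<in> edges_below l" for e
    using assms that unfolding hists_def by auto
  from prob_parents[OF finite_edges_below edges_below_subset this]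
  show "{\<omega> \<in> space M. hist l \<omega> = h} \<in> events"
    and "prob {\<omega> \<in> space M. hist l \<omega> = h} = (\<Prod>e\<in>edges_below l. real (card {h e}) / real (fst e))"
    unfolding hist_eq_event[OF assms] by blast+
qed

lemma measurable_hist: "hist l \<in> measurable M (count_space (hists l))"
proof -
  have "hist l -` {h} \<inter> space M \<in> events" if "h \<in> hists l" for h
  proof -
    have "hist l -` {h} \<inter> space M = {\<omega> \<in> space M. hist l \<omega> = h}" by auto
    then show ?thesis using prob_hist_eq(1)[OF that] by simp
  qed
  then show ?thesis
    unfolding measurable_count_space_eq2[OF finite_hists] using hist_in_hists by auto
qed

lemma borel_measurable_fun_hist:
  fixes f :: "_ \<Rightarrow> real"
  shows "(\<lambda>\<omega>. f (hist l \<omega>)) \<in> borel_measurable M"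
  by (rule measurable_compose[OF measurable_hist]) simp

lemma integrable_fun_hist:
  fixes f :: "_ \<Rightarrow> real"
  shows "integrable M (\<lambda>\<omega>. f (hist l \<omega>))"
proof (rule integrable_const_bound)
  show "AE \<omega> in M. norm (f (hist l \<omega>)) \<le> (\<Sum>h\<in>hists l. norm (f h))"
    using hist_in_hists by (intro AE_I2 member_le_sum) auto
qed (rule borel_measurable_fun_hist)

lemma event_hist: "{\<omega> \<in> space M. P (hist l \<omega>)} \<in> events"
proof -
  have "hist l -` {h \<in> hists l. P h} \<inter> space M \<in> events"
    by (rule measurable_sets[OF measurable_hist]) auto
  also have "hist l -` {h \<in> hists l. P h} \<inter> space M = {\<omega> \<in> space M. P (hist l \<omega>)}"
    using hist_in_hists by auto
  finally show ?thesis .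
qed

lemma expectation_sum_hist:
  fixes f :: "_ \<Rightarrow> real"
  assumes ev: "\<And>h. h \<in> hists l \<Longrightarrow> {\<omega> \<in> space M. hist l \<omega> = h \<and> Q h \<omega>} \<in> events"
  shows "expectation (\<lambda>\<omega>. f (hist l \<omega>) * of_bool (Q (hist l \<omega>) \<omega>))
    = (\<Sum>h\<in>hists l. f h * prob {\<omega> \<in> space M. hist l \<omega> = h \<and> Q h \<omega>})"
proof -
  have "f (hist l \<omega>) * of_bool (Q (hist l \<omega>) \<omega>)
      = (\<Sum>h\<in>hists l. f h * indicator {\<omega> \<in> space M. hist l \<omega> = h \<and> Q h \<omega>} \<omega>)"
    if "\<omega> \<in> space M" for \<omega>
  proof -
    have "(\<Sum>h\<in>hists l. f h * indicator {\<omega> \<in> space M. hist l \<omega> = h \<and> Q h \<omega>} \<omega>)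
        = (\<Sum>h\<in>hists l. if h = hist l \<omega> then f h * of_bool (Q h \<omega>) else 0)"
      using that by (intro sum.cong) (auto simp: indicator_def)
    also have "\<dots> = f (hist l \<omega>) * of_bool (Q (hist l \<omega>) \<omega>)"
      using hist_in_hists[OF that] by (simp add: sum.delta)
    finally show ?thesis by simp
  qed
  then have "expectation (\<lambda>\<omega>. f (hist l \<omega>) * of_bool (Q (hist l \<omega>) \<omega>))
    = expectation (\<lambda>\<omega>. \<Sum>h\<in>hists l. f h * indicator {\<omega> \<in> space M. hist l \<omega> = h \<and> Q h \<omega>} \<omega>)"
    by (intro Bochner_Integration.integral_cong) auto
  also have "\<dots> = (\<Sum>h\<in>hists l. expectation (\<lambda>\<omega>. f h * indicator {\<omega> \<in> space M. hist l \<omega> = h \<and> Q h \<omega>} \<omega>))"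
    using ev by (intro Bochner_Integration.integral_sum integrable_mult_right) (auto simp: emeasure_eq_measure)
  also have "\<dots> = (\<Sum>h\<in>hists l. f h * prob {\<omega> \<in> space M. hist l \<omega> = h \<and> Q h \<omega>})"
    using ev by (intro sum.cong refl) (auto simp: Int_absorb2)
  finally show ?thesis .
qed

lemma hist_parents_eq:
  assumes "\<omega> \<in> space M" "1 \<le> m" "m < l" "j < k"
  shows "hist l \<omega> (m, j) = parent (m, j) \<omega>" "parent (m, j) \<omega> < m"
  using assms parent_less[of m j \<omega>] by (auto simp: hist_def edges_below_def dag_edges_def)

lemma hist_near:
  assumes "\<omega> \<in> space M"
  shows "i < l \<Longrightarrow> near k (hist l \<omega>) t i \<longleftrightarrow> near k (parents \<omega>) t i"
    and "i \<le> l \<Longrightarrow> far_count k (hist l \<omega>) t i = far_count k (parents \<omega>) t i"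
    and "i \<le> l \<Longrightarrow> far_frac k (hist l \<omega>) t i = far_frac k (parents \<omega>) t i"
proof -
  note h = hist_parents_eq[OF assms]
  show "near k (hist l \<omega>) t i \<longleftrightarrow> near k (parents \<omega>) t i" if "i < l"
    by (rule near_cong[where n = l]) (use h that in blast)+
  show "far_count k (hist l \<omega>) t i = far_count k (parents \<omega>) t i" if "i \<le> l"
    by (rule far_frac_cong(1)[where n = l]) (use h that in blast)+
  show "far_frac k (hist l \<omega>) t i = far_frac k (parents \<omega>) t i" if "i \<le> l"
    by (rule far_frac_cong(2)[where n = l]) (use h that in blast)+
qed

text \<open>
  The identity behind all estimates: conditionally on the choices below \<open>l\<close>, each of the \<open>k\<close> parents
  of \<open>l\<close> is uniform on \<open>{..<l}\<close>, hence further than \<open>t\<close> from the root with probability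
  \<open>far_frac k _ t l\<close>, and the \<open>k\<close> choices are independent. The arbitrary weight \<open>f\<close> of the past
  expresses the conditioning.
\<close>

lemma expectation_far_step:
  fixes f :: "_ \<Rightarrow> real"
  assumes "1 \<le> l"
  shows "expectation (\<lambda>\<omega>. f (hist l \<omega>) * of_bool (\<not> near k (parents \<omega>) (Suc t) l))
    = expectation (\<lambda>\<omega>. f (hist l \<omega>) * far_frac k (parents \<omega>) t l ^ k)"
proof -
  define B where "B h = {i \<in> {..<l}. \<not> near k h t i}" for h
  let ?Q = "\<lambda>h \<omega>. \<forall>j<k. parent (l, j) \<omega> \<in> B h"
  have l_edge: "(l, j) \<in> dag_edges k" if "j < k" for j
    using that assms by (simp add: dag_edges_def)
  have far_iff: "\<not> near k (parents \<omega>) (Suc t) l \<longleftrightarrow> ?Q (hist l \<omega>) \<omega>" if "\<omega> \<in> space M" for \<omega>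
  proof -
    have "\<not> near k (parents \<omega>) t (parent (l, j) \<omega>) \<longleftrightarrow> parent (l, j) \<omega> \<in> B (hist l \<omega>)" if "j < k" for j
      using parent_less[OF l_edge[OF that] \<open>\<omega> \<in> space M\<close>]
        hist_near(1)[OF \<open>\<omega> \<in> space M\<close>, of "parent (l, j) \<omega>" l t]
      unfolding B_def by blast
    then show ?thesis using assms by auto
  qed
  have p: "{\<omega> \<in> space M. hist l \<omega> = h \<and> ?Q h \<omega>} \<in> events"
    "prob {\<omega> \<in> space M. hist l \<omega> = h \<and> ?Q h \<omega>} = prob {\<omega> \<in> space M. hist l \<omega> = h} * far_frac k h t l ^ k"
    if h: "h \<in> hists l" for h
  proof -
    let ?A = "\<lambda>e. if fst e = l then B h else {h e}"
    let ?J = "edges_below l \<union> {l} \<times> {..<k}"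
    have lt: "fst e < l" if "e \<in> edges_below l" for e using that by (auto simp: edges_below_def)
    have eq: "{\<omega> \<in> space M. hist l \<omega> = h \<and> ?Q h \<omega>} = {\<omega> \<in> space M. \<forall>e\<in>?J. parent e \<omega> \<in> ?A e}"
      (is "?L = ?R")
    proof -
      have "?L = {\<omega> \<in> space M. hist l \<omega> = h} \<inter> {\<omega> \<in> space M. ?Q h \<omega>}" by blast
      also have "\<dots> = {\<omega> \<in> space M. \<forall>e\<in>edges_below l. parent e \<omega> \<in> {h e}} \<inter> {\<omega> \<in> space M. ?Q h \<omega>}"
        unfolding hist_eq_event[OF h] ..
      also have "\<dots> = ?R"
      proof -
        have "(\<forall>e\<in>edges_below l. parent e \<omega> \<in> ?A e) \<longleftrightarrow> (\<forall>e\<in>edges_below l. parent e \<omega> \<in> {h e})" for \<omega>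
          using lt by (intro ball_cong refl) auto
        moreover have "(\<forall>e\<in>{l} \<times> {..<k}. parent e \<omega> \<in> ?A e) \<longleftrightarrow> ?Q h \<omega>" for \<omega>
          by auto
        ultimately show ?thesis unfolding ball_Un by blast
      qed
      finally show ?thesis .
    qed
    have J: "finite ?J" "?J \<subseteq> dag_edges k" using edges_below_subset l_edge by auto
    have A: "?A e \<subseteq> {..<fst e}" if "e \<in> ?J" for e
    proof (cases "fst e = l")
      case True
      then show ?thesis unfolding B_def by auto
    next
      case False
      then have "e \<in> edges_below l" using that by auto
      then show ?thesis using False h PiE_mem[of h "edges_below l" _ e] unfolding hists_def by auto
    qed
    note pp = prob_parents[OF J A]
    show "{\<omega> \<in> space M. hist l \<omega> = h \<and> ?Q h \<omega>} \<in> events" using pp(1) unfolding eq .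
    have "prob {\<omega> \<in> space M. hist l \<omega> = h \<and> ?Q h \<omega>} = (\<Prod>e\<in>?J. real (card (?A e)) / real (fst e))"
      using pp(2) unfolding eq .
    also have "\<dots> = (\<Prod>e\<in>edges_below l. real (card (?A e)) / real (fst e)) * (\<Prod>e\<in>{l} \<times> {..<k}. real (card (?A e)) / real (fst e))"
      by (intro prod.union_disjoint) (auto simp: edges_below_def)
    also have "(\<Prod>e\<in>edges_below l. real (card (?A e)) / real (fst e)) = (\<Prod>e\<in>edges_below l. real (card {h e}) / real (fst e))"
      using lt by (intro prod.cong refl) auto
    also have "\<dots> = prob {\<omega> \<in> space M. hist l \<omega> = h}" by (rule prob_hist_eq(2)[OF h, symmetric])
    also have "(\<Prod>e\<in>{l} \<times> {..<k}. real (card (?A e)) / real (fst e)) = (\<Prod>e\<in>{l} \<times> {..<k}. far_frac k h t l)"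
      by (intro prod.cong) (auto simp: far_frac_def far_count_def B_def)
    also have "\<dots> = far_frac k h t l ^ k" by simp
    finally show "prob {\<omega> \<in> space M. hist l \<omega> = h \<and> ?Q h \<omega>} = prob {\<omega> \<in> space M. hist l \<omega> = h} * far_frac k h t l ^ k" .
  qed
  have "expectation (\<lambda>\<omega>. f (hist l \<omega>) * of_bool (\<not> near k (parents \<omega>) (Suc t) l))
      = expectation (\<lambda>\<omega>. f (hist l \<omega>) * of_bool (?Q (hist l \<omega>) \<omega>))"
    using far_iff by (intro Bochner_Integration.integral_cong) auto
  also have "\<dots> = (\<Sum>h\<in>hists l. f h * prob {\<omega> \<in> space M. hist l \<omega> = h \<and> ?Q h \<omega>})"
    by (rule expectation_sum_hist[OF p(1)])
  also have "\<dots> = (\<Sum>h\<in>hists l. (f h * far_frac k h t l ^ k) * prob {\<omega> \<in> space M. hist l \<omega> = h \<and> True})"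
    by (intro sum.cong) (auto simp: p(2))
  also have "\<dots> = expectation (\<lambda>\<omega>. (f (hist l \<omega>) * far_frac k (hist l \<omega>) t l ^ k) * of_bool True)"
    using prob_hist_eq(1) by (intro expectation_sum_hist[symmetric]) simp
  also have "\<dots> = expectation (\<lambda>\<omega>. f (hist l \<omega>) * far_frac k (parents \<omega>) t l ^ k)"
    by (intro Bochner_Integration.integral_cong) (auto simp: hist_near)
  finally show ?thesis .
qed

lemma event_near: "{\<omega> \<in> space M. P (near k (parents \<omega>) t l)} \<in> events"
proof -
  have "{\<omega> \<in> space M. P (near k (parents \<omega>) t l)} = {\<omega> \<in> space M. P (near k (hist (Suc l) \<omega>) t l)}"
    using hist_near(1)[of _ l "Suc l"] by auto
  then show ?thesis using event_hist[of "\<lambda>h. P (near k h t l)"] by simp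
qed

lemma borel_measurable_far_frac: "(\<lambda>\<omega>. far_frac k (parents \<omega>) t l) \<in> borel_measurable M"
proof -
  have "(\<lambda>\<omega>. far_frac k (parents \<omega>) t l) \<in> borel_measurable M \<longleftrightarrow> (\<lambda>\<omega>. far_frac k (hist l \<omega>) t l) \<in> borel_measurable M"
    by (intro measurable_cong) (simp add: hist_near)
  then show ?thesis using borel_measurable_fun_hist[of "\<lambda>h. far_frac k h t l"] by simp
qed

lemma integrable_far_frac:
  "integrable M (\<lambda>\<omega>. far_frac k (parents \<omega>) t l)"
  "integrable M (\<lambda>\<omega>. far_frac k (parents \<omega>) t l ^ p)"
  using borel_measurable_far_frac
  by (auto intro!: integrable_const_bound[of _ 1] power_le_one AE_I2 simp: far_frac_le_1 abs_of_nonneg)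

lemma expectation_far_frac:
  "expectation (\<lambda>\<omega>. far_frac k (parents \<omega>) t l)
    = (\<Sum>i<l. prob {\<omega> \<in> space M. \<not> near k (parents \<omega>) t i}) / l"
proof -
  have "far_frac k (parents \<omega>) t l = (\<Sum>i<l. indicator {\<omega> \<in> space M. \<not> near k (parents \<omega>) t i} \<omega>) / l"
    if "\<omega> \<in> space M" for \<omega>
  proof -
    have "real (far_count k (parents \<omega>) t l) = (\<Sum>i<l. indicator {\<omega> \<in> space M. \<not> near k (parents \<omega>) t i} \<omega>)"
      using that by (induction l) (auto simp: far_count_Suc)
    then show ?thesis by (simp add: far_frac_def)
  qed
  then have "expectation (\<lambda>\<omega>. far_frac k (parents \<omega>) t l)
    = expectation (\<lambda>\<omega>. (\<Sum>i<l. indicator {\<omega> \<in> space M. \<not> near k (parents \<omega>) t i} \<omega>) / l)"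
    by (intro Bochner_Integration.integral_cong) auto
  also have "\<dots> = (\<Sum>i<l. expectation (indicator {\<omega> \<in> space M. \<not> near k (parents \<omega>) t i})) / l"
    using event_near[of Not]
    by (subst integral_divide_zero, subst Bochner_Integration.integral_sum)
       (auto simp: emeasure_eq_measure)
  also have "\<dots> = (\<Sum>i<l. prob {\<omega> \<in> space M. \<not> near k (parents \<omega>) t i}) / l"
    using event_near[of Not] by (simp add: Int_absorb2)
  finally show ?thesis .
qed

lemma prob_far_Suc:
  assumes "1 \<le> l"
  shows "prob {\<omega> \<in> space M. \<not> near k (parents \<omega>) (Suc t) l} = expectation (\<lambda>\<omega>. far_frac k (parents \<omega>) t l ^ k)"
proof -
  have "prob {\<omega> \<in> space M. \<not> near k (parents \<omega>) (Suc t) l}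
    = expectation (indicator {\<omega> \<in> space M. \<not> near k (parents \<omega>) (Suc t) l})"
    by (simp add: Int_absorb2)
  also have "\<dots> = expectation (\<lambda>\<omega>. 1 * of_bool (\<not> near k (parents \<omega>) (Suc t) l))"
    by (intro Bochner_Integration.integral_cong) (auto simp: indicator_def)
  also have "\<dots> = expectation (\<lambda>\<omega>. 1 * far_frac k (parents \<omega>) t l ^ k)"
    using expectation_far_step[OF assms, of "\<lambda>_. 1" t] .
  finally show ?thesis by simp
qed

end

section \<open>First moment bounds\<close>

text \<open>
  The coefficients \<open>\<Gamma>(l + a) / (\<Gamma>(a) l!)\<close> of \<open>(1 - z)^(-a)\<close>. Summation multiplies this generating
  function by \<open>1 / (1 - z)\<close>, so averaging over \<open>{..<l}\<close> merely divides the weight by \<open>a\<close>: it is an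
  eigenfunction of the averaging operator in the recursion for the distances, a discrete version of
  \<open>l^(a - 1)\<close>.
\<close>

definition gamma_weight :: "real \<Rightarrow> nat \<Rightarrow> real" where
  "gamma_weight a l = pochhammer a l / fact l"

lemma gamma_weight_0 [simp]: "gamma_weight a 0 = 1"
  by (simp add: gamma_weight_def)

lemma gamma_weight_Suc: "gamma_weight a (Suc l) = gamma_weight a l * ((a + l) / (1 + l))"
  by (simp add: gamma_weight_def pochhammer_Suc)

lemma sum_gamma_weight:
  assumes "0 < a"
  shows "(\<Sum>i<l. gamma_weight a i) = l / a * gamma_weight a l"
  using assms
proof (induction l)
  case (Suc l)
  have "real l / a + 1 = (a + l) / a" using \<open>0 < a\<close> by (simp add: divide_simps)
  moreover have "(\<Sum>i<Suc l. gamma_weight a i) = (real l / a + 1) * gamma_weight a l"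
    using Suc by (simp add: algebra_simps)
  ultimately show ?case using \<open>0 < a\<close> by (simp add: gamma_weight_Suc divide_simps)
qed simp

lemma gamma_weight_nonneg: "0 < a \<Longrightarrow> 0 \<le> gamma_weight a l"
  by (simp add: gamma_weight_def pochhammer_nonneg)

text \<open>
  The weight is the product of the factors \<open>1 - (1 - a) / i\<close> for \<open>1 \<le> i \<le> l\<close>, hence at most
  \<open>exp (- (1 - a) H)\<close> for the harmonic number \<open>H\<close>.
\<close>

lemma gamma_weight_le:
  assumes "0 < a" "a \<le> 1" "1 \<le> l"
  shows "gamma_weight a l \<le> real l powr (a - 1)"
proof -
  have "ln (real l) \<le> ln (real l + 1)" using assms by simp
  also have "\<dots> \<le> harm l" by (rule ln_le_harm)
  finally have "- (1 - a) * harm l \<le> (a - 1) * ln (real l)"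
    using assms mult_left_mono[of "ln (real l)" "harm l" "1 - a"] by (simp add: algebra_simps)
  moreover have "gamma_weight a n \<le> exp (- (1 - a) * harm n)" for n
  proof (induction n)
    case (Suc n)
    have "(a + real n) / (1 + real n) = 1 + - (1 - a) * inverse (1 + real n)"
      by (simp add: field_simps)
    also have "\<dots> \<le> exp (- (1 - a) * inverse (1 + real n))"
      by (rule exp_ge_add_one_self)
    finally have "gamma_weight a (Suc n)
        \<le> exp (- (1 - a) * harm n) * exp (- (1 - a) * inverse (1 + real n))"
      unfolding gamma_weight_Suc using Suc assms gamma_weight_nonneg[of a n]
      by (intro mult_mono) auto
    also have "\<dots> = exp (- (1 - a) * harm (Suc n))"
      unfolding exp_add[symmetric] harm_Suc by (simp add: distrib_left add.commute)
    finally show ?case .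
  qed (simp add: harm_def)
  ultimately have "gamma_weight a l \<le> exp ((a - 1) * ln (real l))"
    by (meson exp_le_cancel_iff order_trans)
  then show ?thesis using assms by (simp add: powr_def)
qed

context uniform_random_dag
begin

lemma prob_near_eq: "prob {\<omega> \<in> space M. near k (parents \<omega>) t l} = 1 - prob {\<omega> \<in> space M. \<not> near k (parents \<omega>) t l}"
proof -
  have "{\<omega> \<in> space M. near k (parents \<omega>) t l} = space M - {\<omega> \<in> space M. \<not> near k (parents \<omega>) t l}" by auto
  then show ?thesis using prob_compl[OF event_near[of Not t l]] by simp
qed

lemma prob_near_Suc_le:
  assumes "1 \<le> l"
  shows "prob {\<omega> \<in> space M. near k (parents \<omega>) (Suc t) l}
    \<le> k / l * (\<Sum>i<l. prob {\<omega> \<in> space M. near k (parents \<omega>) t i})"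
proof -
  let ?X = "\<lambda>\<omega>. far_frac k (parents \<omega>) t l"
  have "1 + real k * (expectation ?X - 1) = expectation (\<lambda>\<omega>. 1 + real k * (?X \<omega> - 1))"
    using integrable_far_frac by (simp add: prob_space)
  also have "\<dots> \<le> expectation (\<lambda>\<omega>. ?X \<omega> ^ k)"
  proof (rule integral_mono)
    show "1 + real k * (?X \<omega> - 1) \<le> ?X \<omega> ^ k" for \<omega>
      using Bernoulli_inequality[of "?X \<omega> - 1" k] by simp
  qed (use integrable_far_frac in auto)
  also have "\<dots> = 1 - prob {\<omega> \<in> space M. near k (parents \<omega>) (Suc t) l}"
    unfolding prob_near_eq prob_far_Suc[OF assms] by simp
  finally have "prob {\<omega> \<in> space M. near k (parents \<omega>) (Suc t) l} \<le> k * (1 - expectation ?X)"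
    by (simp add: algebra_simps)
  also have "1 - expectation ?X = (\<Sum>i<l. prob {\<omega> \<in> space M. near k (parents \<omega>) t i}) / l"
    using assms unfolding expectation_far_frac prob_near_eq sum_subtractf by (simp add: diff_divide_distrib)
  finally show ?thesis by simp
qed

text \<open>
  A Chernoff bound in disguise: the linearised recursion \<open>prob_near_Suc_le\<close> multiplies the
  eigenfunction \<open>gamma_weight a\<close> by \<open>k / a\<close>, and the eigenfunction dominates the indicator of the
  root, which is the state at \<open>t = 0\<close>.
\<close>

lemma prob_near_le:
  fixes a :: real
  assumes "0 < a" "a \<le> k"
  shows "prob {\<omega> \<in> space M. near k (parents \<omega>) t l} \<le> (k / a) ^ t * gamma_weight a l"
proof (induction t arbitrary: l)
  case 0
  show ?case using gamma_weight_nonneg[OF assms(1)] by (cases "l = 0") (auto simp: prob_space)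
next
  case (Suc t)
  show ?case
  proof (cases "l = 0")
    case True
    have "1 \<le> (k / a) ^ Suc t" using assms by (intro one_le_power) simp
    then show ?thesis using True by (auto simp: prob_space)
  next
    case False
    have "prob {\<omega> \<in> space M. near k (parents \<omega>) (Suc t) l}
        \<le> k / l * (\<Sum>i<l. prob {\<omega> \<in> space M. near k (parents \<omega>) t i})"
      using False by (intro prob_near_Suc_le) auto
    also have "\<dots> \<le> k / l * (\<Sum>i<l. (k / a) ^ t * gamma_weight a i)"
      by (intro mult_left_mono sum_mono Suc) auto
    also have "\<dots> = k / l * ((k / a) ^ t * (l / a * gamma_weight a l))"
      unfolding sum_distrib_left[symmetric] sum_gamma_weight[OF assms(1)] ..
    also have "\<dots> = (k / a) ^ Suc t * gamma_weight a l"
      using False by simp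
    finally show ?thesis .
  qed
qed

text \<open>
  Bounding \<open>X^k\<close> by \<open>X\<close> amounts to following a single parent. The depth \<open>D\<close> of node \<open>l\<close> in the resulting
  random recursive tree has \<open>E 2^D = l + 1\<close>, and Markov's inequality gives the bound. It is far from
  optimal, and enough for the nodes up to a small power of \<open>n\<close>.
\<close>

lemma prob_far_le:
  assumes "0 < k"
  shows "prob {\<omega> \<in> space M. \<not> near k (parents \<omega>) t l} \<le> (real l + 1) / 2 ^ t"
proof (induction t arbitrary: l)
  case 0
  then show ?case using prob_le_1 by (intro order_trans[OF prob_le_1]) auto
next
  case (Suc t)
  show ?case
  proof (cases "l = 0")
    case False
    then have l: "1 \<le> l" by simp
    have "prob {\<omega> \<in> space M. \<not> near k (parents \<omega>) (Suc t) l}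
        = expectation (\<lambda>\<omega>. far_frac k (parents \<omega>) t l ^ k)"
      by (rule prob_far_Suc[OF l])
    also have "\<dots> \<le> expectation (\<lambda>\<omega>. far_frac k (parents \<omega>) t l ^ 1)"
      using assms by (intro integral_mono power_decreasing integrable_far_frac) (auto simp: far_frac_le_1)
    also have "\<dots> = (\<Sum>i<l. prob {\<omega> \<in> space M. \<not> near k (parents \<omega>) t i}) / l"
      using expectation_far_frac[of t l] by simp
    also have "\<dots> \<le> (\<Sum>i<l. (real i + 1) / 2 ^ t) / l"
      by (intro divide_right_mono sum_mono Suc) auto
    also have "(\<Sum>i<l. (real i + 1) / 2 ^ t) = real l * (real l + 1) / 2 / 2 ^ t"
      unfolding sum_divide_distrib[symmetric]
      by (intro arg_cong2[where f = "(/)"] refl, induction l) (auto simp: field_simps)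
    also have "real l * (real l + 1) / 2 / 2 ^ t / real l = (real l + 1) / 2 ^ Suc t"
      using l by (simp add: field_simps)
    finally show ?thesis by simp
  qed (auto simp del: near.simps)
qed

section \<open>Concentration of the number of far nodes\<close>

text \<open>
  The exponential supermartingale of the process that adds the indicator of \<open>S\<^sub>l > t + 1\<close> at time \<open>l\<close>;
  an indicator of conditional probability \<open>p\<close> has exponential moment
  \<open>1 + (exp s - 1) p \<le> exp ((exp s - 1) p)\<close>.
\<close>

definition far_mart :: "real \<Rightarrow> nat \<Rightarrow> nat \<Rightarrow> (nat \<times> nat \<Rightarrow> nat) \<Rightarrow> real" where
  "far_mart s t l par = exp (s * far_count k par (Suc t) l - (exp s - 1) * (\<Sum>i<l. far_frac k par t i ^ k))"

lemma far_mart_hist: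
  assumes "\<omega> \<in> space M" "l \<le> n"
  shows "far_mart s t l (hist n \<omega>) = far_mart s t l (parents \<omega>)"
proof -
  have "(\<Sum>i<l. far_frac k (hist n \<omega>) t i ^ k) = (\<Sum>i<l. far_frac k (parents \<omega>) t i ^ k)"
    using assms by (intro sum.cong refl) (auto simp: hist_near)
  then show ?thesis using assms by (simp add: far_mart_def hist_near)
qed

lemma integrable_far_mart: "integrable M (\<lambda>\<omega>. far_mart s t l (parents \<omega>))"
proof -
  have "integrable M (\<lambda>\<omega>. far_mart s t l (parents \<omega>)) \<longleftrightarrow> integrable M (\<lambda>\<omega>. far_mart s t l (hist l \<omega>))"
    by (intro Bochner_Integration.integrable_cong) (auto simp: far_mart_hist)
  then show ?thesis using integrable_fun_hist by simp
qed

lemma integrable_if_fun_hist: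
  assumes "\<And>\<omega>. \<omega> \<in> space M \<Longrightarrow> g \<omega> = h (hist n \<omega>)"
  shows "integrable M (g :: _ \<Rightarrow> real)"
proof -
  have "integrable M g \<longleftrightarrow> integrable M (\<lambda>\<omega>. h (hist n \<omega>))"
    by (rule Bochner_Integration.integrable_cong) (auto simp: assms)
  then show ?thesis using integrable_fun_hist by simp
qed

lemma expectation_far_mart_le_1:
  assumes k: "0 < k" and s: "0 \<le> s"
  shows "expectation (\<lambda>\<omega>. far_mart s t l (parents \<omega>)) \<le> 1"
proof (induction l)
  case 0
  then show ?case by (simp add: far_mart_def prob_space)
next
  case (Suc l)
  show ?case
  proof (cases "l = 0")
    case True
    then show ?thesis using k by (simp add: far_mart_def prob_space far_count_Suc zero_power)
  next
    case False
    let ?X = "\<lambda>\<omega>. far_frac k (parents \<omega>) t l"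
    let ?far = "\<lambda>\<omega>. of_bool (\<not> near k (parents \<omega>) (Suc t) l) :: real"
    define c where "c = exp s - 1"
    define f where "f h = far_mart s t l h * exp (- (c * far_frac k h t l ^ k))" for h
    have f_pos: "0 < f h" for h by (simp add: f_def far_mart_def)
    have f_hist: "f (hist l \<omega>) = f (parents \<omega>)" if "\<omega> \<in> space M" for \<omega>
      unfolding f_def using that by (simp add: far_mart_hist hist_near)
    have step: "far_mart s t (Suc l) (parents \<omega>) = f (hist l \<omega>) + c * (f (hist l \<omega>) * ?far \<omega>)"
      if "\<omega> \<in> space M" for \<omega>
    proof -
      have "far_mart s t (Suc l) (parents \<omega>) = f (parents \<omega>) * exp (s * ?far \<omega>)"
        unfolding f_def far_mart_def far_count_Suc c_def exp_add[symmetric]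
        by (simp add: algebra_simps del: near.simps)
      also have "exp (s * ?far \<omega>) = 1 + c * ?far \<omega>" by (simp add: c_def del: near.simps)
      finally show ?thesis unfolding f_hist[OF that] by (simp add: algebra_simps del: near.simps)
    qed
    have int1: "integrable M (\<lambda>\<omega>. f (hist l \<omega>))" by (rule integrable_fun_hist)
    have int2: "integrable M (\<lambda>\<omega>. f (hist l \<omega>) * ?X \<omega> ^ k)"
      by (rule integrable_if_fun_hist[where n = l and h = "\<lambda>h. f h * far_frac k h t l ^ k"]) (simp add: hist_near)
    have int3: "integrable M (\<lambda>\<omega>. f (hist l \<omega>) * ?far \<omega>)"
      by (rule integrable_if_fun_hist[where n = "Suc l" and h = "\<lambda>h. f h * of_bool (\<not> near k h (Suc t) l)"])
        (simp add: hist_near f_hist f_def far_mart_hist del: near.simps)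
    have "expectation (\<lambda>\<omega>. far_mart s t (Suc l) (parents \<omega>))
        = expectation (\<lambda>\<omega>. f (hist l \<omega>) + c * (f (hist l \<omega>) * ?far \<omega>))"
      by (rule Bochner_Integration.integral_cong) (simp_all only: step)
    also have "\<dots> = expectation (\<lambda>\<omega>. f (hist l \<omega>)) + c * expectation (\<lambda>\<omega>. f (hist l \<omega>) * ?far \<omega>)"
      using int1 int3 by (simp del: near.simps)
    also have "expectation (\<lambda>\<omega>. f (hist l \<omega>) * ?far \<omega>) = expectation (\<lambda>\<omega>. f (hist l \<omega>) * ?X \<omega> ^ k)"
      using False by (intro expectation_far_step) simp
    also have "expectation (\<lambda>\<omega>. f (hist l \<omega>)) + c * expectation (\<lambda>\<omega>. f (hist l \<omega>) * ?X \<omega> ^ k)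
        = expectation (\<lambda>\<omega>. f (hist l \<omega>) + c * (f (hist l \<omega>) * ?X \<omega> ^ k))"
      using int1 int2 by simp
    also have "\<dots> \<le> expectation (\<lambda>\<omega>. far_mart s t l (parents \<omega>))"
    proof (rule integral_mono)
      fix \<omega> assume \<omega>: "\<omega> \<in> space M"
      have "f (hist l \<omega>) + c * (f (hist l \<omega>) * ?X \<omega> ^ k) = f (parents \<omega>) * (1 + c * ?X \<omega> ^ k)"
        by (simp add: algebra_simps f_hist[OF \<omega>])
      also have "\<dots> \<le> f (parents \<omega>) * exp (c * ?X \<omega> ^ k)"
        using f_pos[of "parents \<omega>"] by (intro mult_left_mono exp_ge_add_one_self) simp
      also have "\<dots> = far_mart s t l (parents \<omega>)"
        unfolding f_def by (simp add: mult.assoc exp_add[symmetric])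
      finally show "f (hist l \<omega>) + c * (f (hist l \<omega>) * ?X \<omega> ^ k) \<le> far_mart s t l (parents \<omega>)" .
    qed (use int1 int2 integrable_far_mart in auto)
    finally show ?thesis using Suc by simp
  qed
qed

lemma event_far_count_gt:
  fixes c d :: real
  shows "{\<omega> \<in> space M. c + d * (\<Sum>i<l. far_frac k (parents \<omega>) t i ^ k) < real (far_count k (parents \<omega>) (Suc t) l)} \<in> events"
proof -
  have "{\<omega> \<in> space M. c + d * (\<Sum>i<l. far_frac k (parents \<omega>) t i ^ k) < real (far_count k (parents \<omega>) (Suc t) l)}
     = {\<omega> \<in> space M. c + d * (\<Sum>i<l. far_frac k (hist l \<omega>) t i ^ k) < real (far_count k (hist l \<omega>) (Suc t) l)}"
    by (intro Collect_cong conj_cong refl) (simp add: hist_near)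
  then show ?thesis
    using event_hist[of "\<lambda>h. c + d * (\<Sum>i<l. far_frac k h t i ^ k) < real (far_count k h (Suc t) l)" l] by simp
qed

text \<open>
  Markov's inequality for \<open>far_mart\<close>, with \<open>exp s - 1 \<le> s (1 + s)\<close>. The multiplicative error \<open>1 + s\<close>
  with a fixed small \<open>s\<close> buys an additive error of only \<open>c / s\<close>, which is logarithmic in \<open>n\<close> when the
  failure probability is polynomially small.
\<close>

lemma prob_far_count_gt:
  fixes c s :: real
  assumes k: "0 < k" and s: "0 < s" "s \<le> 1"
  shows "prob {\<omega> \<in> space M. c / s + (1 + s) * (\<Sum>i<l. far_frac k (parents \<omega>) t i ^ k)
            < real (far_count k (parents \<omega>) (Suc t) l)} \<le> exp (- c)"
    (is "prob ?E \<le> _")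
proof -
  let ?Z = "{\<omega> \<in> space M. exp c \<le> far_mart s t l (parents \<omega>)}"
  have "?E \<subseteq> ?Z"
  proof
    fix \<omega> assume \<omega>: "\<omega> \<in> ?E"
    let ?S = "\<Sum>i<l. far_frac k (parents \<omega>) t i ^ k" and ?N = "real (far_count k (parents \<omega>) (Suc t) l)"
    from \<omega> have gt: "c / s + (1 + s) * ?S < ?N" by simp
    have S: "0 \<le> ?S" by (intro sum_nonneg) simp
    have "exp s - 1 \<le> s * (1 + s)"
      using exp_bound[of s] s by (simp add: power2_eq_square algebra_simps)
    then have "(exp s - 1) * ?S \<le> s * (1 + s) * ?S" using S by (intro mult_right_mono)
    moreover have "s * (c / s + (1 + s) * ?S) < s * ?N"
      using gt s by (intro mult_strict_left_mono)
    moreover have "s * (c / s + (1 + s) * ?S) = c + s * (1 + s) * ?S"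
      using s by (simp add: distrib_left[of s "c / s"])
    ultimately have "c \<le> s * ?N - (exp s - 1) * ?S" by linarith
    then show "\<omega> \<in> ?Z" using \<omega> unfolding far_mart_def by simp
  qed
  moreover have "?Z \<in> events"
    using borel_measurable_integrable[OF integrable_far_mart[of s t l]] by measurable
  ultimately have "prob ?E \<le> prob ?Z"
    by (intro finite_measure_mono)
  also have "\<dots> \<le> expectation (\<lambda>\<omega>. far_mart s t l (parents \<omega>)) / exp c"
    by (rule integral_Markov_inequality_measure[where A = "{}"]) (auto simp: far_mart_def integrable_far_mart[unfolded far_mart_def])
  also have "\<dots> \<le> 1 / exp c"
    using expectation_far_mart_le_1[OF k, of s] s by (intro divide_right_mono) auto
  finally show ?thesis by (simp add: exp_minus inverse_eq_divide)
qed

text \<open>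
  The last step of the upper bound: a node whose predecessors are almost all near is itself far only
  with a tiny probability.
\<close>

lemma prob_far_and_far_frac_le:
  assumes "1 \<le> l" "0 \<le> q"
  shows "{\<omega> \<in> space M. \<not> near k (parents \<omega>) (Suc t) l \<and> far_frac k (parents \<omega>) t l \<le> q} \<in> events"
    and "prob {\<omega> \<in> space M. \<not> near k (parents \<omega>) (Suc t) l \<and> far_frac k (parents \<omega>) t l \<le> q} \<le> q ^ k"
proof -
  let ?E = "{\<omega> \<in> space M. \<not> near k (parents \<omega>) (Suc t) l \<and> far_frac k (parents \<omega>) t l \<le> q}"
  define f where "f h = (of_bool (far_frac k h t l \<le> q) :: real)" for h
  show ev: "?E \<in> events"
  proof -
    have "?E = {\<omega> \<in> space M. \<not> near k (hist (Suc l) \<omega>) (Suc t) l \<and> far_frac k (hist (Suc l) \<omega>) t l \<le> q}"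
      by (intro Collect_cong conj_cong refl) (simp_all add: hist_near del: near.simps)
    then show ?thesis
      using event_hist[of "\<lambda>h. \<not> near k h (Suc t) l \<and> far_frac k h t l \<le> q" "Suc l"] by (simp del: near.simps)
  qed
  have "prob ?E = expectation (indicator ?E)" using ev by (simp add: Int_absorb2 del: near.simps)
  also have "\<dots> = expectation (\<lambda>\<omega>. f (hist l \<omega>) * of_bool (\<not> near k (parents \<omega>) (Suc t) l))"
    by (rule Bochner_Integration.integral_cong) (auto simp: indicator_def f_def hist_near simp del: near.simps)
  also have "\<dots> = expectation (\<lambda>\<omega>. f (hist l \<omega>) * far_frac k (parents \<omega>) t l ^ k)"
    by (rule expectation_far_step[OF assms(1)])
  also have "\<dots> \<le> expectation (\<lambda>\<omega>. q ^ k)"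
  proof (rule integral_mono)
    show "integrable M (\<lambda>\<omega>. f (hist l \<omega>) * far_frac k (parents \<omega>) t l ^ k)"
      by (rule integrable_if_fun_hist[where n = l and h = "\<lambda>h. f h * far_frac k h t l ^ k"]) (simp add: hist_near)
    show "f (hist l \<omega>) * far_frac k (parents \<omega>) t l ^ k \<le> q ^ k" if "\<omega> \<in> space M" for \<omega>
      using that assms(2) by (auto simp: f_def hist_near intro!: power_mono)
  qed auto
  finally show "prob ?E \<le> q ^ k" by (simp add: prob_space)
qed

end

section \<open>The function phi and its root\<close>

text \<open>
  The logarithm of \<open>dag_phi\<close>, with a real parameter \<open>c\<close> in place of \<open>k\<close>; its derivative in \<open>x\<close> is
  \<open>ln (c / x)\<close>.
\<close>

definition log_phi :: "real \<Rightarrow> real \<Rightarrow> real" where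
  "log_phi c x = x * (1 + ln c - ln x) - 1"

lemma dag_phi_eq_exp:
  assumes "0 < x" "0 < k"
  shows "dag_phi k x = exp (log_phi k x)"
  using assms
  by (simp add: dag_phi_def log_phi_def powr_def ln_div ln_mult exp_add[symmetric] algebra_simps)

lemma log_phi_strict_mono:
  assumes "1 < c" "0 < x" "x < y" "y \<le> 1"
  shows "log_phi c x < log_phi c y"
proof (rule DERIV_pos_imp_increasing_open[OF \<open>x < y\<close>])
  fix z assume z: "x < z" "z < y"
  have "((log_phi c) has_real_derivative (ln c - ln z)) (at z)"
    unfolding log_phi_def using z assms by (auto intro!: derivative_eq_intros)
  moreover have "ln z < ln c" using z assms by simp
  ultimately show "\<exists>d. (log_phi c has_real_derivative d) (at z) \<and> 0 < d"
    by (intro exI[of _ "ln c - ln z"]) simp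
qed (use assms in \<open>auto intro!: continuous_intros simp: log_phi_def\<close>)

lemma log_phi_root:
  assumes "1 < c"
  shows "\<exists>x\<in>{0<..<1}. log_phi c x = 0"
proof -
  have "eventually (\<lambda>x. log_phi c x < 0) (at_right 0)"
    unfolding log_phi_def by real_asymp
  moreover have "eventually (\<lambda>x. x \<in> {0<..<1}) (at_right (0::real))"
    by (rule eventually_at_right_real) simp
  ultimately have "eventually (\<lambda>x. log_phi c x < 0 \<and> x \<in> {0<..<1}) (at_right 0)"
    by eventually_elim simp
  then obtain x0 where x0: "log_phi c x0 < 0" "0 < x0" "x0 < 1"
    using eventually_happens[of _ "at_right (0::real)"] by (auto simp: trivial_limit_at_right_real)
  have one: "0 < log_phi c 1" using assms by (simp add: log_phi_def)
  have "continuous_on {x0..1} (log_phi c)"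
    using x0 unfolding log_phi_def by (auto intro!: continuous_intros)
  then obtain x where x: "x0 \<le> x" "x \<le> 1" "log_phi c x = 0"
    using IVT'[of "log_phi c" x0 0 1] x0 one by auto
  then have "x \<noteq> 1" using one by auto
  then show ?thesis using x x0 by force
qed

lemma strict_mono_on_dag_phi:
  assumes "2 \<le> k"
  shows "strict_mono_on {0<..<1} (dag_phi k)"
  using assms by (auto intro!: strict_mono_onI log_phi_strict_mono simp: dag_phi_eq_exp)

lemma dag_phi_root:
  assumes "2 \<le> k"
  shows "\<exists>!x. x \<in> {0<..<1} \<and> dag_phi k x = 1"
proof -
  obtain x where x: "x \<in> {0<..<1}" "log_phi k x = 0"
    using log_phi_root[of "real k"] assms by auto
  show ?thesis
  proof (intro ex1I[of _ x] conjI)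
    show "dag_phi k x = 1" using x assms by (simp add: dag_phi_eq_exp)
    fix y assume y: "y \<in> {0<..<1} \<and> dag_phi k y = 1"
    then have "dag_phi k x = dag_phi k y" using x assms by (simp add: dag_phi_eq_exp)
    then show "y = x"
      using inj_onD[OF strict_mono_on_imp_inj_on[OF strict_mono_on_dag_phi[OF assms]], of x y] x y
      by auto
  qed (use x in auto)
qed

lemma dag_sigma:
  assumes "2 \<le> k"
  shows "0 < dag_sigma k" "dag_sigma k < 1" "log_phi k (dag_sigma k) = 0"
proof -
  have "dag_sigma k \<in> {0<..<1} \<and> dag_phi k (dag_sigma k) = 1"
    unfolding dag_sigma_def by (rule theI'[OF dag_phi_root[OF assms]])
  then show "0 < dag_sigma k" "dag_sigma k < 1" "log_phi k (dag_sigma k) = 0"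
    using assms by (auto simp: dag_phi_eq_exp)
qed

section \<open>A travelling front for the linear recursion\<close>

lemma fact_le_self_power:
  "1 \<le> r \<Longrightarrow> fact (r - 1) \<le> real r ^ r * exp (1 - real r)"
proof (induction r rule: dec_induct)
  case (step r)
  let ?q = "(real r + 1) / real r"
  have r: "0 < real r" using step by simp
  have "ln (real r / (real r + 1)) \<le> real r / (real r + 1) - 1"
    using r by (intro ln_le_minus_one) auto
  moreover have "ln (real r / (real r + 1)) = - ln ?q" using r by (simp add: ln_div)
  moreover have "real r / (real r + 1) - 1 = - (1 / (real r + 1))" using r by (simp add: field_simps)
  ultimately have "1 / (real r + 1) \<le> ln ?q" by linarith
  then have "1 \<le> real (Suc r) * ln ?q" using r by (simp add: divide_le_eq mult.commute add.commute)
  then have "exp 1 \<le> exp (real (Suc r) * ln ?q)" by simp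
  also have "\<dots> = ?q ^ Suc r"
    using r by (simp only: exp_of_nat_mult) (simp add: add_pos_pos)
  finally have pw: "exp 1 * real r ^ Suc r \<le> (real r + 1) ^ Suc r"
    using step by (simp add: power_divide field_simps)
  have "fact (Suc r - 1) = real r * fact (r - 1)"
    using step by (cases r) auto
  also have "\<dots> \<le> real r * (real r ^ r * exp (1 - real r))"
    using step by (intro mult_left_mono) auto
  also have "\<dots> = (exp 1 * real r ^ Suc r) * exp (1 - real (Suc r))"
  proof -
    have "exp (1 - real r) = exp 1 * exp (1 - real (Suc r))" by (simp flip: exp_add)
    then show ?thesis by simp
  qed
  also have "\<dots> \<le> (real r + 1) ^ Suc r * exp (1 - real (Suc r))"
    by (rule mult_right_mono[OF pw]) simp
  finally show ?case by (simp add: add.commute)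
qed simp

text \<open>
  A lower bound for the iterated averages of the indicator of \<open>{..A}\<close>. In continuous space the \<open>j + 1\<close>
  fold average at \<open>l\<close> contains the gamma density term \<open>(A / l) (ln (l / A))^j / j!\<close>. The shift by \<open>d\<close> in
  every step pays for replacing the integrals by sums; it costs little because \<open>d\<close> may be as small as
  \<open>1 / A\<close>.
\<close>

definition growth :: "real \<Rightarrow> nat \<Rightarrow> real \<Rightarrow> real" where
  "growth d j y = max 0 (y - real j * d) ^ j / fact j"

lemma growth_nonneg: "0 \<le> growth d j y"
  by (simp add: growth_def)

lemma power_diff_le:
  fixes u v :: real
  assumes "0 \<le> u" "u \<le> v"
  shows "v ^ Suc j - u ^ Suc j \<le> (real j + 1) * (v - u) * v ^ j"
proof (induction j)
  case (Suc j)
  have "v ^ Suc (Suc j) - u ^ Suc (Suc j) = v * (v ^ Suc j - u ^ Suc j) + (v - u) * u ^ Suc j"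
    by (simp add: algebra_simps)
  also have "\<dots> \<le> v * ((real j + 1) * (v - u) * v ^ j) + (v - u) * v ^ Suc j"
    using assms Suc by (intro add_mono mult_left_mono power_mono) auto
  finally show ?case by (simp add: algebra_simps)
qed simp

text \<open>
  The derivative of \<open>growth d (Suc j)\<close> at \<open>y + h\<close> is \<open>growth\<close> of index \<open>j\<close> at \<open>y + h - d\<close>, which is at
  most \<open>growth d j y\<close> when \<open>h \<le> d\<close>.
\<close>

lemma growth_step:
  assumes "0 \<le> h" "h \<le> d"
  shows "growth d (Suc j) (y + h) \<le> growth d (Suc j) y + h * growth d j y"
proof -
  let ?u = "max 0 (y - real (Suc j) * d)" and ?v = "max 0 (y + h - real (Suc j) * d)"
    and ?w = "max 0 (y - real j * d)"
  have v: "?v \<le> ?u + h" "?v \<le> ?w" "?u \<le> ?v" using assms by (auto simp: algebra_simps)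
  have "?v ^ Suc j - ?u ^ Suc j \<le> (real j + 1) * (?v - ?u) * ?v ^ j"
    using v by (intro power_diff_le) auto
  also have "\<dots> \<le> (real j + 1) * h * ?w ^ j"
    using v assms by (intro mult_mono power_mono mult_nonneg_nonneg) auto
  finally have "(?v ^ Suc j - ?u ^ Suc j) / fact (Suc j) \<le> ((real j + 1) * h * ?w ^ j) / fact (Suc j)"
    by (intro divide_right_mono) auto
  also have "((real j + 1) * h * ?w ^ j) / fact (Suc j) = h * (?w ^ j / fact j)"
    using mult_divide_mult_cancel_left[of "real j + 1" "h * ?w ^ j" "fact j"]
    by (simp add: mult.assoc add.commute)
  finally show ?thesis unfolding growth_def diff_divide_distrib by linarith
qed

lemma growth_le_exp:
  assumes "0 \<le> d" "0 \<le> y"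
  shows "growth d j y \<le> exp y"
proof -
  have "max 0 (y - real j * d) ^ j \<le> y ^ j" using assms by (intro power_mono) auto
  then have "growth d j y \<le> y ^ j / fact j"
    unfolding growth_def by (intro divide_right_mono) auto
  also have "\<dots> = (\<Sum>i\<in>{j}. y ^ i /\<^sub>R fact i)" by (simp add: divide_inverse mult.commute)
  also have "\<dots> \<le> exp y"
    unfolding exp_def using assms by (intro sum_le_suminf summable_exp_generic) auto
  finally show ?thesis .
qed

text \<open>
  The increment of \<open>ln (l / A)\<close> from \<open>l\<close> to \<open>l + 1\<close> is at most \<open>1 / l\<close>, so \<open>growth_step\<close> telescopes. At the
  first \<open>l\<close> above \<open>A\<close> the logarithm is at most \<open>1 / A \<le> d\<close>, and the left hand side still vanishes.
\<close>

lemma growth_sum: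
  assumes A: "0 < A" "1 / A \<le> d"
  shows "growth d (Suc j) (ln (real l / A)) \<le> (\<Sum>i | i < l \<and> A < real i. growth d j (ln (real i / A)) / real i)"
proof (induction l)
  case 0
  have "0 < 1 / A" using A by simp
  then have "0 < d" using A by linarith
  then show ?case by (simp add: growth_def max_def)
next
  case (Suc l)
  let ?f = "\<lambda>i. growth d j (ln (real i / A)) / real i"
  have d: "0 < d" using A by (meson divide_pos_pos less_le_trans zero_less_one)
  show ?case
  proof (cases "A < real l")
    case True
    let ?h = "ln (1 + 1 / real l)"
    have l: "0 < real l" using True A by linarith
    have h: "0 \<le> ?h" "?h \<le> 1 / real l" using l ln_add_one_self_le_self[of "1 / real l"] by auto
    have "1 / real l \<le> 1 / A" using True A l by (simp add: frac_le)
    then have hd: "?h \<le> d" using A h by linarith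
    have "real (Suc l) = real l * (1 + 1 / real l)" using l by (simp add: distrib_left)
    then have "ln (real (Suc l) / A) = ln (real l / A * (1 + 1 / real l))"
      by (simp only: times_divide_eq_left)
    also have "\<dots> = ln (real l / A) + ?h"
      using l A by (intro ln_mult_pos) (auto intro: add_pos_pos)
    finally have "growth d (Suc j) (ln (real (Suc l) / A))
        \<le> growth d (Suc j) (ln (real l / A)) + ?h * growth d j (ln (real l / A))"
      using growth_step[OF h(1) hd] by simp
    also have "\<dots> \<le> (\<Sum>i | i < l \<and> A < real i. ?f i) + 1 / real l * growth d j (ln (real l / A))"
      using h by (intro add_mono Suc mult_right_mono growth_nonneg)
    also have "\<dots> = (\<Sum>i | i < Suc l \<and> A < real i. ?f i)"
    proof -
      have "{i. i < Suc l \<and> A < real i} = insert l {i. i < l \<and> A < real i}"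
        using True by (auto simp: less_Suc_eq)
      then show ?thesis by simp
    qed
    finally show ?thesis .
  next
    case False
    have "real (Suc l) / A \<le> 1 + 1 / A" using False A by (simp add: field_simps)
    then have "ln (real (Suc l) / A) \<le> ln (1 + 1 / A)" using A by (simp add: add_pos_pos)
    also have "\<dots> \<le> 1 / A" using A by (intro ln_add_one_self_le_self) auto
    also have "\<dots> \<le> 1 * d" using A by simp
    also have "\<dots> \<le> real (Suc j) * d" by (rule mult_right_mono) (use d in auto)
    finally have "growth d (Suc j) (ln (real (Suc l) / A)) = 0" by (simp add: growth_def max_def)
    then show ?thesis by (auto intro!: sum_nonneg divide_nonneg_nonneg growth_nonneg)
  qed
qed

text \<open>
  The nonlinearity of the recursion, bounded by a capped linear one: the slope
  \<open>k / (1 + k \<theta>)\<close> is as close to \<open>k\<close> as desired if the cap \<open>\<theta>\<close> is small. It rests on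
  \<open>(1 - z)^k \<le> 1 / (1 + z)^k \<le> 1 / (1 + k z)\<close>.
\<close>

lemma power_le_linear_cap:
  fixes z \<theta> :: real
  assumes z: "0 \<le> z" "z \<le> 1" and \<theta>: "0 \<le> \<theta>"
  shows "(1 - z) ^ k \<le> 1 - real k / (1 + real k * \<theta>) * min z \<theta>"
proof -
  let ?m = "min z \<theta>"
  have m: "0 \<le> ?m" "?m \<le> 1" "?m \<le> \<theta>" "?m \<le> z" using z \<theta> by auto
  have "(1 - ?m) ^ k * (1 + real k * ?m) \<le> (1 - ?m) ^ k * (1 + ?m) ^ k"
    using m Bernoulli_inequality[of ?m k] by (intro mult_left_mono) auto
  also have "\<dots> = (1 - ?m\<^sup>2) ^ k"
    by (simp add: power_mult_distrib[symmetric] power2_eq_square algebra_simps)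
  also have "\<dots> \<le> 1" using m by (intro power_le_one) (auto simp: power_le_one)
  finally have "(1 - ?m) ^ k \<le> 1 / (1 + real k * ?m)"
    using m by (simp add: pos_le_divide_eq add_pos_nonneg)
  also have "\<dots> = 1 - real k * ?m / (1 + real k * ?m)"
    using m by (simp add: field_simps add_pos_nonneg add_nonneg_eq_0_iff)
  also have "\<dots> \<le> 1 - real k * ?m / (1 + real k * \<theta>)"
    using m \<theta> by (intro diff_left_mono divide_left_mono mult_pos_pos add_pos_nonneg add_left_mono mult_left_mono) auto
  finally have "(1 - ?m) ^ k \<le> 1 - real k / (1 + real k * \<theta>) * ?m" by simp
  moreover have "(1 - z) ^ k \<le> (1 - ?m) ^ k" using m z by (intro power_mono) auto
  ultimately show ?thesis by linarith
qed

text \<open>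
  This is where \<open>\<phi>\<close> enters: with \<open>c = k\<close> the right hand side grows like \<open>\<phi>(x)^(r / x)\<close> up to a power
  of \<open>r\<close>, by Stirling's bound. So if \<open>\<phi>(x) > 1\<close>, then it exceeds \<open>2\<close> for large \<open>r\<close>, even for
  some slope \<open>c\<close> below \<open>k\<close>. The summand \<open>1\<close> in \<open>r / x + 1\<close> is room for the shifts in \<open>growth\<close>.
\<close>

lemma block_exists:
  assumes k: "2 \<le> k" and x: "0 < x" "x < 1" and phi: "0 < log_phi k x"
  obtains c r where "0 < c" "c < real k" "1 \<le> r"
    "2 \<le> c ^ r * exp (- (real r / x + 1)) * ((real r / x) ^ (r - 1) / fact (r - 1))"
proof -
  \<comment> \<open>this slope loses exactly half of the exponent: log_phi c x = log_phi k x / 2\<close>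
  define c where "c = real k * exp (- (log_phi k x / (2 * x)))"
  have c: "0 < c" using k by (simp add: c_def)
  have "c < real k * 1"
    unfolding c_def using k x phi by (intro mult_strict_left_mono) auto
  then have ck: "c < real k" by simp
  define a where "a = 1 + ln c - ln x - 1 / x"
  have "ln c = ln k - log_phi k x / (2 * x)" using k by (simp add: c_def ln_mult)
  then have "ln c * x = ln k * x - log_phi k x / 2" using x by (simp add: left_diff_distrib)
  moreover have "a * x = x + ln c * x - ln x * x - 1"
    using x by (simp add: a_def algebra_simps)
  moreover have "log_phi k x = x + ln k * x - ln x * x - 1"
    by (simp add: log_phi_def algebra_simps)
  ultimately have "a * x = log_phi k x / 2" by linarith
  then have "0 < a * x" using phi by simp
  then have a: "0 < a" using x by (simp add: zero_less_mult_iff)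
  have "filterlim (\<lambda>r::nat. exp (- 2) * (x / real r) * exp (a * real r)) at_top at_top"
    using x a by real_asymp
  then have "eventually (\<lambda>r::nat. 2 \<le> exp (- 2) * (x / real r) * exp (a * real r)) at_top"
    by (simp add: filterlim_at_top)
  then have "eventually (\<lambda>r::nat. 2 \<le> exp (- 2) * (x / real r) * exp (a * real r) \<and> 1 \<le> r) at_top"
    using eventually_ge_at_top[of 1] by eventually_elim simp
  then obtain r :: nat where r: "2 \<le> exp (- 2) * (x / real r) * exp (a * real r)" "1 \<le> r"
    using eventually_happens'[OF sequentially_bot] by blast
  let ?b = "real r / x"
  have "exp (- 2) * (x / real r) * exp (a * real r) * (real r ^ r * exp (1 - real r))
      = c ^ r * exp (- (?b + 1)) * ?b ^ (r - 1)"
  proof -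
    let ?R = "real r"
    have R: "0 < ?R" using r by simp
    have e1: "c ^ r = exp (?R * ln c)" and e2: "?R ^ r = exp (?R * ln ?R)"
      and e3: "x / ?R = exp (ln x - ln ?R)"
      using c R x by (simp_all add: exp_of_nat_mult exp_diff)
    have "ln ?b = ln ?R - ln x" using R x by (simp add: ln_div)
    moreover have "?b ^ (r - 1) = exp (real (r - 1) * ln ?b)"
      using R x by (simp only: exp_of_nat_mult) simp
    moreover have "real (r - 1) = ?R - 1" using r by simp
    ultimately have e4: "?b ^ (r - 1) = exp ((?R - 1) * (ln ?R - ln x))" by simp
    have aR: "a * ?R = ?R + ?R * ln c - ?R * ln x - ?R / x"
      by (simp add: a_def right_diff_distrib distrib_left mult.commute[of _ "real r"])
    have "- 2 + (ln x - ln ?R) + a * ?R + (?R * ln ?R + (1 - ?R))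
        = ?R * ln c + - (?b + 1) + (?R - 1) * (ln ?R - ln x)"
      unfolding aR by (simp add: left_diff_distrib right_diff_distrib)
    then show ?thesis unfolding e1 e2 e3 e4 exp_add[symmetric] by (rule arg_cong)
  qed
  moreover have "exp (- 2) * (x / real r) * exp (a * real r) * fact (r - 1)
      \<le> exp (- 2) * (x / real r) * exp (a * real r) * (real r ^ r * exp (1 - real r))"
    using x by (intro mult_left_mono fact_le_self_power[OF r(2)]) auto
  ultimately have "exp (- 2) * (x / real r) * exp (a * real r) * fact (r - 1)
      \<le> c ^ r * exp (- (?b + 1)) * ?b ^ (r - 1)"
    by (simp only:)
  then have "exp (- 2) * (x / real r) * exp (a * real r)
      \<le> c ^ r * exp (- (?b + 1)) * ?b ^ (r - 1) / fact (r - 1)"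
    by (subst pos_le_divide_eq) auto
  then have "2 \<le> c ^ r * exp (- (?b + 1)) * (?b ^ (r - 1) / fact (r - 1))"
    using r(1) unfolding times_divide_eq_right by (rule order_trans[rotated])
  then show ?thesis by (rule that[OF c ck r(2)])
qed

section \<open>The deterministic recursion\<close>

text \<open>
  What remains of the random dag on the event that the number of far nodes never exceeds its
  compensator by more than the allowed deviation; \<open>B\<close> is the additive deviation.
\<close>

locale far_recursion =
  fixes X :: "nat \<Rightarrow> nat \<Rightarrow> real" and k n :: nat and s B :: real
  assumes k: "2 \<le> k" and s: "0 < s" and B: "0 \<le> B"
    and X_nonneg: "\<And>t l. 0 \<le> X t l" and X_le_1: "\<And>t l. X t l \<le> 1"
    and X_mono: "\<And>t t' l. t \<le> t' \<Longrightarrow> X t' l \<le> X t l"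
    and rec: "\<And>t l. 1 \<le> l \<Longrightarrow> l \<le> n \<Longrightarrow> t < n \<Longrightarrow>
      real l * X (Suc t) l \<le> B + (1 + s) * (\<Sum>i<l. X t i ^ k)"
begin

text \<open>
  The recursion in terms of the near fraction \<open>1 - X\<close>, linearised from below. The multiplicative error
  \<open>1 + s\<close> acts on far fractions close to \<open>1\<close> and so costs the near fraction the additive error \<open>s\<close>.
\<close>

lemma near_frac_step:
  assumes "0 \<le> \<theta>" "1 \<le> l" "l \<le> n" "t < n"
  shows "real k / (1 + real k * \<theta>) / real l * (\<Sum>i<l. min (1 - X t i) \<theta>) - (s + B / real l) \<le> 1 - X (Suc t) l"
proof -
  define c where "c = real k / (1 + real k * \<theta>)"
  let ?S = "\<Sum>i<l. min (1 - X t i) \<theta>"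
  have l: "0 < real l" using assms by simp
  have c: "0 \<le> c" using assms unfolding c_def by simp
  have S: "0 \<le> ?S" using assms X_le_1 by (intro sum_nonneg) auto
  have "(\<Sum>i<l. X t i ^ k) \<le> (\<Sum>i<l. 1 - c * min (1 - X t i) \<theta>)"
  proof (rule sum_mono)
    fix i
    show "X t i ^ k \<le> 1 - c * min (1 - X t i) \<theta>"
      using power_le_linear_cap[of "1 - X t i" \<theta> k] X_nonneg[of t i] X_le_1[of t i] assms(1)
      unfolding c_def by simp
  qed
  also have "\<dots> = real l - c * ?S" by (simp add: sum_subtractf sum_distrib_left)
  finally have "(1 + s) * (\<Sum>i<l. X t i ^ k) \<le> (1 + s) * (real l - c * ?S)"
    using s by (intro mult_left_mono) auto
  also have "\<dots> = real l + s * real l - c * ?S - s * (c * ?S)" by (simp add: algebra_simps)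
  also have "\<dots> \<le> real l + s * real l - c * ?S"
    using mult_nonneg_nonneg[OF _ mult_nonneg_nonneg[OF c S], of s] s by linarith
  finally have "real l * X (Suc t) l \<le> B + real l + s * real l - c * ?S"
    using rec[OF assms(2-4)] by linarith
  then have "X (Suc t) l \<le> (B + real l + s * real l - c * ?S) / real l"
    using l by (simp add: pos_le_divide_eq mult.commute)
  also have "\<dots> = B / real l + 1 + s - c / real l * ?S"
    using l by (simp add: add_divide_distrib diff_divide_distrib)
  finally show ?thesis unfolding c_def by linarith
qed

text \<open>
  Induction on \<open>j\<close> with \<open>growth_sum\<close>. The smallness of \<open>\<theta>'\<close> keeps the profile below the cap \<open>\<theta>\<close>
  throughout, so that the linear bound applies; the errors \<open>e\<close> accumulate at most geometrically.
\<close>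

lemma front_profile:
  fixes c \<theta> \<theta>' A e :: real and r t :: nat
  assumes \<theta>: "0 \<le> \<theta>" and c_def: "c = real k / (1 + real k * \<theta>)"
    and \<theta>': "0 \<le> \<theta>'" "\<theta>' * (1 + c) ^ r \<le> \<theta>"
    and A: "0 < A" "1 / A \<le> d" and e: "s + B / A \<le> e"
    and near: "\<And>i. real i \<le> A \<Longrightarrow> i \<le> n \<Longrightarrow> \<theta>' \<le> 1 - X t i"
    and j: "j < r" "t + Suc j \<le> n" and l: "A < real l" "l \<le> n"
  shows "\<theta>' * c ^ Suc j * (A / real l * growth d j (ln (real l / A))) - e * (1 + c) ^ Suc j \<le> 1 - X (t + Suc j) l"
  using j l
proof (induction j arbitrary: l)
  have c: "0 \<le> c" using \<theta> unfolding c_def by simp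
  have e0: "0 \<le> e" using e s B A by (smt (verit) divide_nonneg_pos)
  have step: "c / real l * (\<Sum>i<l. min (1 - X u i) \<theta>) - e \<le> 1 - X (Suc u) l"
    if "A < real l" "l \<le> n" "u < n" for l u
  proof -
    have l: "1 \<le> l" using that A by (cases l) auto
    have "B / real l \<le> B / A" using that A B by (intro divide_left_mono) auto
    then show ?thesis using near_frac_step[OF \<theta> l that(2,3)] e unfolding c_def by linarith
  qed
  {
    case 0
    then have l: "0 < real l" using A by linarith
    let ?I = "{..nat \<lfloor>A\<rfloor>}"
    have I: "real i \<le> A" if "i \<in> ?I" for i
    proof -
      have "real i \<le> real (nat \<lfloor>A\<rfloor>)" using that by simp
      also have "\<dots> = of_int \<lfloor>A\<rfloor>" using A by simp
      also have "\<dots> \<le> A" by simp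
      finally show ?thesis .
    qed
    have "?I \<subseteq> {..<l}" using I 0(3) by (auto simp del: atMost_iff) force
    have "A \<le> real (card ?I)" using A by simp linarith
    then have "A * \<theta>' \<le> real (card ?I) * \<theta>'" using \<theta>' by (intro mult_right_mono)
    also have "\<dots> = (\<Sum>i\<in>?I. \<theta>')" by simp
    also have "\<dots> \<le> (\<Sum>i\<in>?I. min (1 - X t i) \<theta>)"
    proof (rule sum_mono)
      fix i assume i: "i \<in> ?I"
      have "\<theta>' * 1 \<le> \<theta>' * (1 + c) ^ r" using \<theta>' c by (intro mult_left_mono one_le_power) auto
      moreover have "i \<le> n" using i \<open>?I \<subseteq> {..<l}\<close> 0 by auto
      ultimately show "\<theta>' \<le> min (1 - X t i) \<theta>" using near[OF I[OF i]] \<theta>' by auto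
    qed
    also have "\<dots> \<le> (\<Sum>i<l. min (1 - X t i) \<theta>)"
      using \<open>?I \<subseteq> {..<l}\<close> \<theta> X_le_1 by (intro sum_mono2) auto
    finally have "c / real l * (A * \<theta>') \<le> c / real l * (\<Sum>i<l. min (1 - X t i) \<theta>)"
      using c by (intro mult_left_mono) auto
    moreover have "e * 1 \<le> e * (1 + c) ^ Suc 0" using e0 c by (intro mult_left_mono) auto
    moreover have "\<theta>' * c ^ Suc 0 * (A / real l * growth d 0 (ln (real l / A))) = c / real l * (A * \<theta>')"
      by (simp add: growth_def)
    moreover have "c / real l * (\<Sum>i<l. min (1 - X t i) \<theta>) - e \<le> 1 - X (t + Suc 0) l"
      using step[of l t] 0 by simp
    ultimately show ?case by linarith
  next
    case (Suc j)
    then have l: "0 < real l" using A by linarith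
    let ?a = "\<theta>' * c ^ Suc j * A" and ?f = "\<lambda>i. growth d j (ln (real i / A)) / real i"
    let ?I = "{i. i < l \<and> A < real i}"
    let ?E = "e * (1 + c) ^ Suc j"
    have E: "0 \<le> ?E" using e0 c by simp
    have a: "0 \<le> ?a" using \<theta>' c A by simp
    have min_ge: "?a * ?f i - ?E \<le> min (1 - X (t + Suc j) i) \<theta>" if i: "i \<in> ?I" for i
    proof -
      have i0: "0 < real i" using i A by auto
      have "\<theta>' * c ^ Suc j * (A / real i * growth d j (ln (real i / A))) - ?E \<le> 1 - X (t + Suc j) i"
        using Suc.prems i by (intro Suc.IH) auto
      moreover have "\<theta>' * c ^ Suc j * (A / real i * growth d j (ln (real i / A))) = ?a * ?f i" by simp
      moreover have "?a * ?f i \<le> \<theta>"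
      proof -
        have "0 \<le> d" using A by (smt (verit) divide_nonneg_pos)
        then have "growth d j (ln (real i / A)) \<le> exp (ln (real i / A))"
          using i A by (intro growth_le_exp) auto
        also have "\<dots> = real i / A" using i0 A by simp
        finally have "A * ?f i \<le> 1" using i0 A by (simp add: divide_simps mult.commute)
        then have "\<theta>' * c ^ Suc j * (A * ?f i) \<le> \<theta>' * c ^ Suc j * 1"
          using \<theta>' c by (intro mult_left_mono) auto
        also have "c ^ Suc j \<le> (1 + c) ^ Suc j" using c by (intro power_mono) auto
        also have "(1 + c) ^ Suc j \<le> (1 + c) ^ r" using c Suc.prems by (intro power_increasing) auto
        finally show ?thesis using \<theta>' by (simp add: mult_left_mono mult.assoc)
      qed
      ultimately show ?thesis using E by simp
    qed
    have "card ?I \<le> card {..<l}" by (intro card_mono) auto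
    then have cardI: "real (card ?I) * ?E \<le> real l * ?E" using E by (intro mult_right_mono) auto
    have "?a * growth d (Suc j) (ln (real l / A)) \<le> ?a * (\<Sum>i\<in>?I. ?f i)"
      using growth_sum[OF A] a by (intro mult_left_mono) auto
    then have "?a * growth d (Suc j) (ln (real l / A)) - real l * ?E \<le> ?a * (\<Sum>i\<in>?I. ?f i) - real (card ?I) * ?E"
      using cardI by linarith
    also have "\<dots> = (\<Sum>i\<in>?I. ?a * ?f i - ?E)" by (simp add: sum_subtractf sum_distrib_left)
    also have "\<dots> \<le> (\<Sum>i\<in>?I. min (1 - X (t + Suc j) i) \<theta>)" by (intro sum_mono min_ge)
    also have "\<dots> \<le> (\<Sum>i<l. min (1 - X (t + Suc j) i) \<theta>)"
      using \<theta> X_le_1 by (intro sum_mono2) auto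
    finally have "c / real l * (?a * growth d (Suc j) (ln (real l / A)) - real l * ?E)
        \<le> c / real l * (\<Sum>i<l. min (1 - X (t + Suc j) i) \<theta>)"
      using c by (intro mult_left_mono) auto
    moreover have "c / real l * (?a * growth d (Suc j) (ln (real l / A)) - real l * ?E)
        = \<theta>' * c ^ Suc (Suc j) * (A / real l * growth d (Suc j) (ln (real l / A))) - c * ?E"
      using l by (simp add: right_diff_distrib)
    moreover have "c * ?E + e \<le> e * (1 + c) ^ Suc (Suc j)"
    proof -
      have "e * 1 \<le> ?E" using e0 c by (intro mult_left_mono one_le_power) auto
      then show ?thesis by (simp add: algebra_simps)
    qed
    moreover have "c / real l * (\<Sum>i<l. min (1 - X (t + Suc j) i) \<theta>) - e \<le> 1 - X (t + Suc (Suc j)) l"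
      using step[of l "t + Suc j"] Suc.prems by simp
    ultimately show ?case by linarith
  }
qed

end

lemma sum_inverse_squares_tail:
  assumes "1 \<le> m"
  shows "(\<Sum>i | i < l \<and> m < i. 1 / (real i)\<^sup>2) \<le> 1 / real m"
proof -
  have tail: "(\<Sum>i\<in>{m<..m + d}. 1 / (real i)\<^sup>2) \<le> 1 / real m - 1 / real (m + d)" for d
  proof (induction d)
    case (Suc d)
    let ?p = "real (m + d)"
    have p: "0 < ?p" using assms by simp
    have "1 / (?p + 1)\<^sup>2 \<le> 1 / (?p * (?p + 1))"
      using p by (intro divide_left_mono) (auto simp: power2_eq_square add_pos_pos)
    also have "\<dots> = 1 / ?p - 1 / (?p + 1)"
      using p by (simp add: divide_simps)
    finally have "1 / (real (Suc (m + d)))\<^sup>2 \<le> 1 / ?p - 1 / real (Suc (m + d))"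
      by (simp add: add.commute)
    moreover have "{m<..m + Suc d} = insert (Suc (m + d)) {m<..m + d}" by auto
    ultimately show ?case using Suc by simp
  qed simp
  have "(\<Sum>i | i < l \<and> m < i. 1 / (real i)\<^sup>2) \<le> (\<Sum>i\<in>{m<..m + l}. 1 / (real i)\<^sup>2)"
    by (intro sum_mono2) auto
  also have "\<dots> \<le> 1 / real m - 1 / real (m + l)" by (rule tail)
  finally show ?thesis using divide_nonneg_nonneg[of 1 "real (m + l)"] by linarith
qed

lemma power2_add_le:
  fixes a b s :: real
  assumes "0 < s"
  shows "(a + b)\<^sup>2 \<le> (1 + s) * a\<^sup>2 + (1 + 1 / s) * b\<^sup>2"
proof -
  have "0 \<le> (s * a - b)\<^sup>2 / s" using assms by simp
  also have "\<dots> = s * a\<^sup>2 - 2 * a * b + b\<^sup>2 / s"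
    using assms by (simp add: power2_eq_square divide_simps) (simp add: algebra_simps)
  finally show ?thesis by (simp add: power2_eq_square algebra_simps)
qed

context far_recursion
begin

text \<open>
  At distance \<open>b + 1\<close> ahead of the front the profile of \<open>front_profile\<close> has grown to \<open>2 \<theta>'\<close> after \<open>r\<close>
  steps, and at most \<open>\<theta>'\<close> of it is lost to the errors. So a block of \<open>r\<close> steps reproduces the
  hypothesis on a range longer by the factor \<open>exp (b + 1)\<close>, and blocks can be iterated.
\<close>

lemma front_block:
  fixes c \<theta> \<theta>' m e b :: real and r t :: nat
  assumes \<theta>: "0 \<le> \<theta>" and c_def: "c = real k / (1 + real k * \<theta>)"
    and \<theta>': "0 \<le> \<theta>'" "\<theta>' * (1 + c) ^ r \<le> \<theta>"
    and r: "1 \<le> r" and b: "0 < b" "2 \<le> c ^ r * exp (- (b + 1)) * (b ^ (r - 1) / fact (r - 1))"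
    and m: "real r * exp (b + 1) \<le> m"
    and e: "s + B / m * exp (b + 1) \<le> e" "e * (1 + c) ^ r \<le> \<theta>'"
    and near: "\<And>i. real i \<le> A \<Longrightarrow> i \<le> n \<Longrightarrow> \<theta>' \<le> 1 - X t i" and A: "m \<le> A"
    and t: "t + r \<le> n" and l: "real l \<le> A * exp (b + 1)" "l \<le> n"
  shows "\<theta>' \<le> 1 - X (t + r) l"
proof (cases "real l \<le> A")
  case True
  then show ?thesis using near[OF True l(2)] X_mono[of t "t + r" l] by simp
next
  case False
  have "0 < real r * exp (b + 1)" using r by simp
  then have m0: "0 < m" using m by linarith
  have l0: "0 < real l" using False A m0 by linarith
  have c: "0 \<le> c" unfolding c_def using \<theta> by simp
  \<comment> \<open>The profile is only known to be large at distance b + 1 ahead of the front.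
    But the hypothesis on A implies the same hypothesis on every smaller bound,
    and this bound has l exactly at that distance.\<close>
  define A' where "A' = real l * exp (- (b + 1))"
  have A': "0 < A'" "A' \<le> A" "m * exp (- (b + 1)) \<le> A'" "A' < real l"
  proof -
    show "0 < A'" using l0 by (simp add: A'_def)
    have "A' \<le> A * exp (b + 1) * exp (- (b + 1))"
      unfolding A'_def by (intro mult_right_mono l) auto
    then show "A' \<le> A" by (simp add: mult.assoc flip: exp_add)
    show "m * exp (- (b + 1)) \<le> A'" unfolding A'_def using False A by (intro mult_right_mono) auto
    show "A' < real l" unfolding A'_def using l0 b by simp
  qed
  have "real r = real r * exp (b + 1) * exp (- (b + 1))" by (simp add: mult.assoc flip: exp_add)
  also have "\<dots> \<le> m * exp (- (b + 1))" by (intro mult_right_mono m) auto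
  finally have rA: "real r \<le> A'" using A' by linarith
  have "B / A' \<le> B / (m * exp (- (b + 1)))"
    using A' m0 B by (intro divide_left_mono) auto
  also have "\<dots> = B / m * exp (b + 1)" by (simp only: exp_minus divide_inverse inverse_mult_distrib inverse_inverse_eq mult.assoc)
  finally have e': "s + B / A' \<le> e" using e(1) by linarith
  have y: "ln (real l / A') = b + 1" using l0 by (simp add: A'_def exp_minus divide_simps ln_div)
  have r1: "Suc (r - 1) = r" using r by simp
  have "\<theta>' * c ^ Suc (r - 1) * (A' / real l * growth (1 / real r) (r - 1) (ln (real l / A')))
      - e * (1 + c) ^ Suc (r - 1) \<le> 1 - X (t + Suc (r - 1)) l"
  proof (rule front_profile[OF \<theta> c_def \<theta>'])
    show "0 < A'" "s + B / A' \<le> e" "A' < real l" "l \<le> n" by fact+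
    show "1 / A' \<le> 1 / real r" using rA r by (intro divide_left_mono) auto
    show "\<theta>' \<le> 1 - X t i" if "real i \<le> A'" "i \<le> n" for i using near[of i] that A' by linarith
  qed (use r t in auto)
  then have "\<theta>' * c ^ r * (A' / real l * growth (1 / real r) (r - 1) (b + 1)) - e * (1 + c) ^ r \<le> 1 - X (t + r) l"
    unfolding r1 y .
  moreover have "\<theta>' * 2 \<le> \<theta>' * c ^ r * (A' / real l * growth (1 / real r) (r - 1) (b + 1))"
  proof -
    have "real (r - 1) * (1 / real r) \<le> 1" using r by (simp add: divide_simps)
    then have "b ^ (r - 1) / fact (r - 1) \<le> growth (1 / real r) (r - 1) (b + 1)"
      unfolding growth_def using b by (intro divide_right_mono power_mono) auto
    then have "c ^ r * exp (- (b + 1)) * (b ^ (r - 1) / fact (r - 1))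
        \<le> c ^ r * exp (- (b + 1)) * growth (1 / real r) (r - 1) (b + 1)"
      using c by (intro mult_left_mono) auto
    then have "2 \<le> c ^ r * exp (- (b + 1)) * growth (1 / real r) (r - 1) (b + 1)" using b by linarith
    then have "\<theta>' * 2 \<le> \<theta>' * (c ^ r * exp (- (b + 1)) * growth (1 / real r) (r - 1) (b + 1))"
      using \<theta>' by (intro mult_left_mono)
    also have "exp (- (b + 1)) = A' / real l" using l0 by (simp add: A'_def)
    finally show ?thesis by (simp only: mult.assoc)
  qed
  ultimately show ?thesis using e(2) by linarith
qed

lemma front_reaches:
  fixes c \<theta> \<theta>' m e b :: real and r t q :: nat
  assumes \<theta>: "0 \<le> \<theta>" and c_def: "c = real k / (1 + real k * \<theta>)"
    and \<theta>': "0 \<le> \<theta>'" "\<theta>' * (1 + c) ^ r \<le> \<theta>"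
    and r: "1 \<le> r" and b: "0 < b" "2 \<le> c ^ r * exp (- (b + 1)) * (b ^ (r - 1) / fact (r - 1))"
    and m: "real r * exp (b + 1) \<le> m"
    and e: "s + B / m * exp (b + 1) \<le> e" "e * (1 + c) ^ r \<le> \<theta>'"
    and near: "\<And>i. real i \<le> m \<Longrightarrow> i \<le> n \<Longrightarrow> \<theta>' \<le> 1 - X t i"
    and t: "t + r * q \<le> n" and l: "real l \<le> m * exp (b + 1) ^ q" "l \<le> n"
  shows "\<theta>' \<le> 1 - X (t + r * q) l"
  using t l
proof (induction q arbitrary: l)
  case 0
  then show ?case using near by simp
next
  case (Suc q)
  have "0 \<le> real r * exp (b + 1)" by simp
  then have "0 \<le> m" using m by linarith
  have "\<theta>' \<le> 1 - X (t + r * q + r) l"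
  proof (rule front_block[OF \<theta> c_def \<theta>' r b m e])
    show "\<theta>' \<le> 1 - X (t + r * q) i" if "real i \<le> m * exp (b + 1) ^ q" "i \<le> n" for i
      using Suc.IH that Suc.prems by simp
    have "m * 1 \<le> m * exp (b + 1) ^ q"
      using b \<open>0 \<le> m\<close> by (intro mult_left_mono one_le_power) auto
    then show "m \<le> m * exp (b + 1) ^ q" by simp
  qed (use Suc.prems in \<open>auto simp: mult_ac\<close>)
  then show ?case by (simp add: add.commute add.left_commute)
qed

text \<open>
  With \<open>X \<le> a + 2 B / l\<close> the sum of the \<open>X^k \<le> X\<^sup>2\<close> is about \<open>a\<^sup>2 l\<close> plus a convergent series, whose
  tail beyond \<open>m\<close> is negligible. So the constant part of the bound is essentially squared in every step, while the
  part of order \<open>1 / l\<close> remains of the size of the deviation \<open>B\<close>.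
\<close>

lemma collapse:
  fixes \<theta>' \<rho> :: real and m t :: nat
  assumes start: "\<And>l. l \<le> n \<Longrightarrow> \<theta>' \<le> 1 - X t l" and \<theta>': "\<theta>' \<le> 1"
    and \<rho>: "\<rho> = (1 + s)\<^sup>2 * (1 - \<theta>')"
    and m: "1 \<le> m" "4 * B * (1 + s) * (1 + 1 / s) \<le> real m"
    and zero: "\<And>l. l \<le> m \<Longrightarrow> X t l = 0"
    and j: "t + j \<le> n" and l: "1 \<le> l" "l \<le> n"
  shows "X (t + j) l \<le> \<rho> ^ 2 ^ j / (1 + s)\<^sup>2 + 2 * B / real l"
  using j l
proof (induction j arbitrary: l)
  case 0
  have "\<rho> / (1 + s)\<^sup>2 = 1 - \<theta>'" using s unfolding \<rho> by simp
  moreover have "0 \<le> 2 * B / real l" using B by simp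
  ultimately show ?case using start[of l] 0 by simp
next
  case (Suc j)
  let ?a = "\<rho> ^ 2 ^ j / (1 + s)\<^sup>2"
  have l0: "0 < real l" and m0: "0 < real m" using Suc m by auto
  let ?I = "{i. i < l \<and> m < i}"
  have "(\<Sum>i<l. X (t + j) i ^ k) = (\<Sum>i\<in>?I. X (t + j) i ^ k)"
  proof (rule sum.mono_neutral_right)
    have "X (t + j) i = 0" if "i \<le> m" for i
      using X_nonneg[of "t + j" i] X_mono[of t "t + j" i] zero[OF that] by simp
    then show "\<forall>i\<in>{..<l} - ?I. X (t + j) i ^ k = 0"
      using k by (metis (no_types, lifting) DiffE lessThan_iff mem_Collect_eq not_less power_eq_0_iff zero_less_numeral order.strict_trans2)
  qed auto
  also have "\<dots> \<le> (\<Sum>i\<in>?I. (1 + s) * ?a\<^sup>2 + (1 + 1 / s) * (2 * B / real i)\<^sup>2)"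
  proof (rule sum_mono)
    fix i assume i: "i \<in> ?I"
    have "X (t + j) i ^ k \<le> X (t + j) i ^ 2"
      using k X_nonneg X_le_1 by (intro power_decreasing) auto
    also have "\<dots> \<le> (?a + 2 * B / real i)\<^sup>2"
      using Suc.prems i X_nonneg by (intro power_mono Suc.IH) auto
    also have "\<dots> \<le> (1 + s) * ?a\<^sup>2 + (1 + 1 / s) * (2 * B / real i)\<^sup>2"
      by (rule power2_add_le[OF s])
    finally show "X (t + j) i ^ k \<le> \<dots>" .
  qed
  also have "\<dots> = real (card ?I) * ((1 + s) * ?a\<^sup>2) + (1 + 1 / s) * (4 * B\<^sup>2) * (\<Sum>i\<in>?I. 1 / (real i)\<^sup>2)"
    by (simp add: sum.distrib sum_distrib_left power_divide power_mult_distrib)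
  also have "\<dots> \<le> real l * ((1 + s) * ?a\<^sup>2) + (1 + 1 / s) * (4 * B\<^sup>2) * (1 / real m)"
  proof (intro add_mono mult_right_mono mult_left_mono sum_inverse_squares_tail m)
    have "card ?I \<le> card {..<l}" by (intro card_mono) auto
    then show "real (card ?I) \<le> real l" by simp
  qed (use s in auto)
  finally have "(1 + s) * (\<Sum>i<l. X (t + j) i ^ k)
      \<le> (1 + s) * (real l * ((1 + s) * ?a\<^sup>2) + (1 + 1 / s) * (4 * B\<^sup>2) * (1 / real m))"
    using s by (intro mult_left_mono) auto
  also have "\<dots> = real l * ((1 + s)\<^sup>2 * ?a\<^sup>2) + (4 * B * (1 + s) * (1 + 1 / s)) * (B / real m)"
  proof -
    have "(1 + s) * (real l * ((1 + s) * P) + u * (4 * B\<^sup>2) * (1 / real m))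
        = real l * ((1 + s)\<^sup>2 * P) + (4 * B * (1 + s) * u) * (B / real m)" for P u :: real
      by (simp add: power2_eq_square algebra_simps add_divide_distrib)
    then show ?thesis .
  qed
  also have "(4 * B * (1 + s) * (1 + 1 / s)) * (B / real m) \<le> real m * (B / real m)"
    using B by (intro mult_right_mono m) auto
  also have "(1 + s)\<^sup>2 * ?a\<^sup>2 = \<rho> ^ 2 ^ Suc j / (1 + s)\<^sup>2"
    using s by (simp add: power2_eq_square power_mult[symmetric] mult_2 power_add mult.commute)
  finally have "real l * X (Suc (t + j)) l \<le> real l * (\<rho> ^ 2 ^ Suc j / (1 + s)\<^sup>2) + 2 * B"
    using rec[of l "t + j"] Suc.prems m0 by simp
  then have "X (Suc (t + j)) l \<le> (real l * (\<rho> ^ 2 ^ Suc j / (1 + s)\<^sup>2) + 2 * B) / real l"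
    using l0 by (simp only: pos_le_divide_eq mult.commute)
  also have "\<dots> = \<rho> ^ 2 ^ Suc j / (1 + s)\<^sup>2 + 2 * B / real l"
    using l0 by (simp add: add_divide_distrib)
  finally show ?case by simp
qed

end

section \<open>Distances in the random dag\<close>

context uniform_random_dag
begin

lemma S_le_iff:
  assumes "0 < k" "\<omega> \<in> space M"
  shows "S l \<omega> \<le> t \<longleftrightarrow> near k (parents \<omega>) t l"
  unfolding S_def
  by (rule near_iff_shortest_path) (use assms parent_less in auto)

lemma S_eq_hist:
  assumes "0 < k" "\<omega> \<in> space M" "l < n"
  shows "S l \<omega> = (LEAST t. near k (hist n \<omega>) t l)"
proof (rule Least_equality[symmetric])
  show "near k (hist n \<omega>) (S l \<omega>) l"
    using S_le_iff[OF assms(1,2), of l "S l \<omega>"] hist_near(1)[OF assms(2,3)] by simp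
  show "S l \<omega> \<le> t" if "near k (hist n \<omega>) t l" for t
    using S_le_iff[OF assms(1,2), of l t] hist_near(1)[OF assms(2,3)] that by simp
qed

lemma borel_measurable_S:
  assumes "0 < k"
  shows "(\<lambda>\<omega>. real (S l \<omega>) / c) \<in> borel_measurable M"
  by (rule borel_measurable_integrable[OF integrable_if_fun_hist[where n = "Suc l"
          and h = "\<lambda>h. real (LEAST t. near k h t l) / c"]])
    (simp add: S_eq_hist[OF assms])

lemma borel_measurable_Max_S:
  assumes "0 < k"
  shows "(\<lambda>\<omega>. real (MAX l\<in>{1..n}. S l \<omega>) / c) \<in> borel_measurable M"
proof (rule borel_measurable_integrable[OF integrable_if_fun_hist[where n = "Suc n"
          and h = "\<lambda>h. real (MAX l\<in>{1..n}. LEAST t. near k h t l) / c"]])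
  fix \<omega> assume "\<omega> \<in> space M"
  then have "S l \<omega> = (LEAST t. near k (hist (Suc n) \<omega>) t l)" if "l \<in> {1..n}" for l
    using that by (intro S_eq_hist assms) auto
  then show "real (MAX l\<in>{1..n}. S l \<omega>) / c = real (MAX l\<in>{1..n}. LEAST t. near k (hist (Suc n) \<omega>) t l) / c"
    by simp
qed

lemma prob_exists_far_below:
  assumes "0 < k"
  shows "prob (\<Union>i\<in>{..m}. {\<omega> \<in> space M. \<not> near k (parents \<omega>) t i}) \<le> (real m + 1)\<^sup>2 / 2 ^ t"
proof -
  have "prob (\<Union>i\<in>{..m}. {\<omega> \<in> space M. \<not> near k (parents \<omega>) t i})
      \<le> (\<Sum>i\<in>{..m}. prob {\<omega> \<in> space M. \<not> near k (parents \<omega>) t i})"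
    using event_near[of Not] by (intro finite_measure_subadditive_finite) auto
  also have "\<dots> \<le> (\<Sum>i\<in>{..m}. (real m + 1) / 2 ^ t)"
  proof (rule sum_mono)
    fix i assume "i \<in> {..m}"
    then have "(real i + 1) / 2 ^ t \<le> (real m + 1) / 2 ^ t" by (intro divide_right_mono) auto
    then show "prob {\<omega> \<in> space M. \<not> near k (parents \<omega>) t i} \<le> (real m + 1) / 2 ^ t"
      using prob_far_le[OF assms, of t i] by linarith
  qed
  also have "\<dots> = (real m + 1)\<^sup>2 / 2 ^ t" by (simp add: power2_eq_square add.commute)
  finally show ?thesis .
qed

definition deviation :: "real \<Rightarrow> real \<Rightarrow> nat \<Rightarrow> nat \<Rightarrow> 'w set" where
  "deviation s B l t = {\<omega> \<in> space M. B + (1 + s) * (\<Sum>i<l. far_frac k (parents \<omega>) t i ^ k)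
            < real (far_count k (parents \<omega>) (Suc t) l)}"

lemma prob_exists_deviation:
  assumes k: "0 < k" and s: "0 < s" "s \<le> 1" and n: "1 \<le> n" and B: "B = 3 * ln (real n) / s"
  shows "(\<Union>p\<in>{1..n} \<times> {..<n}. deviation s B (fst p) (snd p)) \<in> events"
    and "prob (\<Union>p\<in>{1..n} \<times> {..<n}. deviation s B (fst p) (snd p)) \<le> 1 / real n"
proof -
  have ev: "deviation s B l t \<in> events" for l t
    unfolding deviation_def by (rule event_far_count_gt)
  then show "(\<Union>p\<in>{1..n} \<times> {..<n}. deviation s B (fst p) (snd p)) \<in> events"
    by (intro sets.finite_UN) auto
  have "prob (\<Union>p\<in>{1..n} \<times> {..<n}. deviation s B (fst p) (snd p))
      \<le> (\<Sum>p\<in>{1..n} \<times> {..<n}. prob (deviation s B (fst p) (snd p)))"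
    using ev by (intro finite_measure_subadditive_finite) auto
  also have "\<dots> \<le> (\<Sum>p\<in>{1..n} \<times> {..<n}. exp (- (3 * ln (real n))))"
    unfolding deviation_def B by (intro sum_mono prob_far_count_gt[OF k s])
  also have "\<dots> = real n * real n * exp (- (3 * ln (real n)))" by simp
  also have "exp (- (3 * ln (real n))) = 1 / real n ^ 3"
    using n exp_of_nat_mult[of 3 "ln (real n)"] by (simp add: exp_minus inverse_eq_divide)
  also have "real n * real n * (1 / real n ^ 3) = 1 / real n"
    using n by (simp add: power3_eq_cube)
  finally show "prob (\<Union>p\<in>{1..n} \<times> {..<n}. deviation s B (fst p) (snd p)) \<le> 1 / real n" .
qed

lemma far_recursion_outside_deviation:
  assumes k: "2 \<le> k" and s: "0 < s" and B: "0 \<le> B" and \<omega>: "\<omega> \<in> space M"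
    and dev: "\<And>l t. 1 \<le> l \<Longrightarrow> l \<le> n \<Longrightarrow> t < n \<Longrightarrow> \<omega> \<notin> deviation s B l t"
  shows "far_recursion (far_frac k (parents \<omega>)) k n s B"
proof
  fix t l assume lt: "1 \<le> l" "l \<le> n" "t < n"
  have "real l * far_frac k (parents \<omega>) (Suc t) l = real (far_count k (parents \<omega>) (Suc t) l)"
    using lt by (simp add: far_frac_def)
  then show "real l * far_frac k (parents \<omega>) (Suc t) l \<le> B + (1 + s) * (\<Sum>i<l. far_frac k (parents \<omega>) t i ^ k)"
    using dev[OF lt] \<omega> unfolding deviation_def by auto
qed (use assms far_frac_le_1 far_frac_mono in auto)

text \<open>
  The upper bound for finite \<open>n\<close>. A node \<open>l \<le> n\<close> can be far at time \<open>t + 1\<close> in three ways only: a node up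
  to \<open>m\<close> is far at time \<open>t0\<close>; some number of far nodes deviates; or neither happens, so that the
  far fraction below \<open>l\<close> is at most \<open>\<alpha> + 2 B / l\<close> at time \<open>t\<close>, and \<open>l\<close> is far nevertheless. The three
  summands bound the respective probabilities.
\<close>

lemma prob_exists_far_le:
  fixes c \<theta> \<theta>' s b B \<rho> \<alpha> :: real and r n m t0 q J :: nat
  assumes k: "2 \<le> k"
    and \<theta>: "0 \<le> \<theta>" and c_def: "c = real k / (1 + real k * \<theta>)"
    and \<theta>': "0 \<le> \<theta>'" "\<theta>' \<le> 1" "\<theta>' * (1 + c) ^ r \<le> \<theta>"
    and r: "1 \<le> r" and b: "0 < b" "2 \<le> c ^ r * exp (- (b + 1)) * (b ^ (r - 1) / fact (r - 1))"
    and s: "0 < s" "s \<le> 1" "2 * s * (1 + c) ^ r \<le> \<theta>'"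
    and n: "1 \<le> n" and B: "B = 3 * ln (real n) / s"
    and m: "real r * exp (b + 1) \<le> real m" "1 \<le> m" "4 * B * (1 + s) * (1 + 1 / s) \<le> real m"
      "B / real m * exp (b + 1) \<le> s" "2 * B / real m \<le> 1 / 2"
    and q: "real n \<le> real m * exp (b + 1) ^ q"
    and t: "t = t0 + r * q + J" "t < n"
    and \<rho>: "\<rho> = (1 + s)\<^sup>2 * (1 - \<theta>')" "\<rho> ^ 2 ^ J / (1 + s)\<^sup>2 = \<alpha>" "\<alpha> \<le> 1 / 2"
  shows "prob {\<omega> \<in> space M. \<exists>l\<le>n. \<not> near k (parents \<omega>) (Suc t) l}
    \<le> (real m + 1)\<^sup>2 / 2 ^ t0 + 1 / real n + (2 * real n * \<alpha>\<^sup>2 + 8 * B\<^sup>2 / real m)"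
proof -
  let ?far = "\<lambda>t l. {\<omega> \<in> space M. \<not> near k (parents \<omega>) t l}"
  let ?q = "\<lambda>l. \<alpha> + 2 * B / real l"
  let ?late = "\<lambda>l. {\<omega> \<in> space M. \<not> near k (parents \<omega>) (Suc t) l \<and> far_frac k (parents \<omega>) t l \<le> ?q l}"
  define E1 where "E1 = (\<Union>i\<in>{..m}. ?far t0 i)"
  define E2 where "E2 = (\<Union>p\<in>{1..n} \<times> {..<n}. deviation s B (fst p) (snd p))"
  define E3 where "E3 = (\<Union>l\<in>{m<..n}. ?late l)"
  note s3 = s(3)
  have k0: "0 < k" using k by simp
  have B0: "0 \<le> B" using s n unfolding B by simp
  have "0 \<le> \<rho>" unfolding \<rho>(1) using \<theta>'(2) by simp
  then have \<alpha>0: "0 \<le> \<alpha>" unfolding \<rho>(2)[symmetric] by (intro divide_nonneg_nonneg zero_le_power zero_le_power2)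
  have q0: "0 \<le> ?q l" for l using \<alpha>0 B0 by simp
  have sub: "{\<omega> \<in> space M. \<exists>l\<le>n. \<not> near k (parents \<omega>) (Suc t) l} \<subseteq> E1 \<union> E2 \<union> E3"
  proof
    fix \<omega> assume "\<omega> \<in> {\<omega> \<in> space M. \<exists>l\<le>n. \<not> near k (parents \<omega>) (Suc t) l}"
    then obtain l where \<omega>: "\<omega> \<in> space M" and l: "l \<le> n" "\<not> near k (parents \<omega>) (Suc t) l"
      by (auto simp del: near.simps)
    show "\<omega> \<in> E1 \<union> E2 \<union> E3"
    proof (rule ccontr)
      assume not: "\<omega> \<notin> E1 \<union> E2 \<union> E3"
      let ?X = "far_frac k (parents \<omega>)"
      have near0: "near k (parents \<omega>) t0 i" if "i \<le> m" for i
      proof (rule ccontr)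
        assume "\<not> near k (parents \<omega>) t0 i"
        then have "\<omega> \<in> E1" unfolding E1_def using that \<omega> by (intro UN_I[of i]) simp_all
        then show False using not by simp
      qed
      have lm: "m < l"
      proof (rule ccontr)
        assume "\<not> m < l"
        then have "near k (parents \<omega>) (Suc t) l"
          unfolding t(1) by (intro near_mono[OF _ near0]) linarith+
        with l(2) show False by (rule notE)
      qed
      have dev: "\<omega> \<notin> deviation s B l' t'" if "1 \<le> l'" "l' \<le> n" "t' < n" for l' t'
      proof
        assume "\<omega> \<in> deviation s B l' t'"
        then have "\<omega> \<in> E2" unfolding E2_def using that by (intro UN_I[of "(l', t')"]) simp_all
        then show False using not by blast
      qed
      interpret far_recursion ?X k n s B
        by (rule far_recursion_outside_deviation[OF k s(1) B0 \<omega>]) (rule dev)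
      have X0: "?X t0 i = 0" if "i \<le> m" for i
        using near0 that by (intro far_frac_eq_0) auto
      have reach: "\<theta>' \<le> 1 - ?X (t0 + r * q) i" if "i \<le> n" for i
      proof (rule front_reaches[OF \<theta> c_def \<theta>'(1,3) r b m(1) _ s3])
        show "s + B / real m * exp (b + 1) \<le> 2 * s" using m(4) by linarith
        show "\<theta>' \<le> 1 - ?X t0 i" if "real i \<le> real m" for i using X0 that \<theta>'(2) by simp
        show "real i \<le> real m * exp (b + 1) ^ q" using q that by linarith
        show "t0 + r * q \<le> n" using t by linarith
      qed (rule that)
      have "?X (t0 + r * q + J) l \<le> \<rho> ^ 2 ^ J / (1 + s)\<^sup>2 + 2 * B / real l"
      proof (rule collapse[OF reach \<theta>'(2) \<rho>(1) m(2,3)])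
        show "?X (t0 + r * q) i = 0" if "i \<le> m" for i
          using X0[OF that] X_mono[of t0 "t0 + r * q" i] X_nonneg[of "t0 + r * q" i] by simp
        show "t0 + r * q + J \<le> n" using t by linarith
        show "1 \<le> l" "l \<le> n" using lm l by linarith+
      qed
      then have "?X t l \<le> ?q l" unfolding \<rho>(2) t(1)[symmetric] .
      then have "\<omega> \<in> ?late l" using \<omega> l(2) by (simp del: near.simps)
      then have "\<omega> \<in> E3" unfolding E3_def using lm l(1) by (intro UN_I[of l]) simp_all
      then show False using not by simp
    qed
  qed
  have ev3: "?late l \<in> events" "prob (?late l) \<le> 2 * \<alpha>\<^sup>2 + 8 * B\<^sup>2 * (1 / (real l)\<^sup>2)" if "l \<in> {m<..n}" for l
  proof -
    have l1: "1 \<le> l" using that by auto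
    note late = prob_far_and_far_frac_le[OF l1 q0[of l], of t]
    show "?late l \<in> events" by (rule late(1))
    have "2 * B / real l \<le> 2 * B / real m"
      using that m(2) B0 by (intro divide_left_mono) auto
    then have "?q l \<le> 1" using m(5) \<rho>(3) by linarith
    then have "?q l ^ k \<le> ?q l ^ 2" using q0 k by (intro power_decreasing) auto
    also have "\<dots> \<le> (1 + 1) * \<alpha>\<^sup>2 + (1 + 1 / 1) * (2 * B / real l)\<^sup>2"
      by (rule power2_add_le) simp
    also have "\<dots> = 2 * \<alpha>\<^sup>2 + 8 * B\<^sup>2 * (1 / (real l)\<^sup>2)" by (simp add: power_divide power_mult_distrib)
    finally show "prob (?late l) \<le> 2 * \<alpha>\<^sup>2 + 8 * B\<^sup>2 * (1 / (real l)\<^sup>2)"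
      using late(2) by linarith
  qed
  \<comment> \<open>(a + b)^2 is at most 2 a^2 + 2 b^2, and the squares 1 / l^2 sum to at most 1 / m beyond m\<close>
  have "prob E3 \<le> (\<Sum>l\<in>{m<..n}. prob (?late l))"
    unfolding E3_def by (rule finite_measure_subadditive_finite) (use ev3(1) in blast)+
  also have "\<dots> \<le> (\<Sum>l\<in>{m<..n}. 2 * \<alpha>\<^sup>2 + 8 * B\<^sup>2 * (1 / (real l)\<^sup>2))"
    by (intro sum_mono ev3(2))
  also have "\<dots> = real (n - m) * (2 * \<alpha>\<^sup>2) + 8 * B\<^sup>2 * (\<Sum>l\<in>{m<..n}. 1 / (real l)\<^sup>2)"
    unfolding sum.distrib sum_distrib_left[symmetric] by simp
  also have "{m<..n} = {l. l < Suc n \<and> m < l}" by auto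
  also have "real (n - m) * (2 * \<alpha>\<^sup>2) + 8 * B\<^sup>2 * (\<Sum>l | l < Suc n \<and> m < l. 1 / (real l)\<^sup>2)
      \<le> real n * (2 * \<alpha>\<^sup>2) + 8 * B\<^sup>2 * (1 / real m)"
  proof (rule add_mono)
    show "real (n - m) * (2 * \<alpha>\<^sup>2) \<le> real n * (2 * \<alpha>\<^sup>2)" by (rule mult_right_mono) simp_all
    show "8 * B\<^sup>2 * (\<Sum>l | l < Suc n \<and> m < l. 1 / (real l)\<^sup>2) \<le> 8 * B\<^sup>2 * (1 / real m)"
      by (rule mult_left_mono[OF sum_inverse_squares_tail[OF m(2)]]) simp
  qed
  finally have p3: "prob E3 \<le> 2 * real n * \<alpha>\<^sup>2 + 8 * B\<^sup>2 / real m" by simp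
  have p1: "prob E1 \<le> (real m + 1)\<^sup>2 / 2 ^ t0"
    unfolding E1_def by (rule prob_exists_far_below[OF k0])
  have p2: "E2 \<in> events" "prob E2 \<le> 1 / real n"
    unfolding E2_def by (rule prob_exists_deviation[OF k0 s(1,2) n B])+
  have ev: "E1 \<in> events" "E3 \<in> events"
    unfolding E1_def E3_def by (rule sets.finite_UN; (simp only: finite_atMost finite_greaterThanAtMost event_near[of Not] ev3(1))?)+
  have "prob {\<omega> \<in> space M. \<exists>l\<le>n. \<not> near k (parents \<omega>) (Suc t) l} \<le> prob (E1 \<union> E2 \<union> E3)"
    by (rule finite_measure_mono[OF sub]) (use ev p2(1) in auto)
  also have "\<dots> \<le> prob E1 + prob E2 + prob E3"
  proof -
    have "prob (E1 \<union> E2 \<union> E3) \<le> prob (E1 \<union> E2) + prob E3"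
      by (rule measure_Un_le) (use ev p2(1) in auto)
    moreover have "prob (E1 \<union> E2) \<le> prob E1 + prob E2"
      by (rule measure_Un_le) (use ev p2(1) in auto)
    ultimately show ?thesis by linarith
  qed
  finally show ?thesis using p1 p2(2) p3 by linarith
qed

text \<open>
  The bound \<open>prob_near_le\<close> with the optimal parameter \<open>a = x\<close> is at most \<open>n^(log \<phi>(x))\<close> for \<open>t \<le> x ln n\<close>.
\<close>

lemma near_early_tendsto_0:
  assumes k: "2 \<le> k" and x: "0 < x" "x < dag_sigma k"
  shows "(\<lambda>n. prob {\<omega> \<in> space M. near k (parents \<omega>) (nat \<lfloor>x * ln (real n)\<rfloor>) n}) \<longlonglongrightarrow> 0"
proof (rule tendsto_sandwich[of "\<lambda>_. 0" _ _ "\<lambda>n. real n powr log_phi k x"])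
  note \<sigma> = dag_sigma[OF k]
  have neg: "log_phi k x < 0"
    using log_phi_strict_mono[of "real k" x "dag_sigma k"] \<sigma> x k by simp
  show "eventually (\<lambda>n. prob {\<omega> \<in> space M. near k (parents \<omega>) (nat \<lfloor>x * ln (real n)\<rfloor>) n}
      \<le> real n powr log_phi k x) at_top"
    using eventually_ge_at_top[of 1]
  proof eventually_elim
    case (elim n)
    have L: "0 \<le> x * ln (real n)" using elim x by simp
    have kx: "1 \<le> real k / x" using k x \<sigma> by (simp add: divide_simps)
    have "prob {\<omega> \<in> space M. near k (parents \<omega>) (nat \<lfloor>x * ln (real n)\<rfloor>) n}
        \<le> (real k / x) ^ nat \<lfloor>x * ln (real n)\<rfloor> * gamma_weight x n"
      using x k \<sigma> by (intro prob_near_le) auto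
    also have "\<dots> \<le> (real k / x) powr (x * ln (real n)) * real n powr (x - 1)"
    proof (intro mult_mono gamma_weight_le)
      have "(real k / x) ^ nat \<lfloor>x * ln (real n)\<rfloor> = (real k / x) powr real (nat \<lfloor>x * ln (real n)\<rfloor>)"
        using kx by (simp add: powr_realpow)
      also have "\<dots> \<le> (real k / x) powr (x * ln (real n))"
        using kx L by (intro powr_mono) auto
      finally show "(real k / x) ^ nat \<lfloor>x * ln (real n)\<rfloor> \<le> (real k / x) powr (x * ln (real n))" .
    qed (use x \<sigma> elim gamma_weight_nonneg in auto)
    also have "\<dots> = exp (x * ln (real n) * (ln (real k) - ln x) + (x - 1) * ln (real n))"
      using x k elim by (simp add: powr_def ln_div exp_add)
    also have "x * ln (real n) * (ln (real k) - ln x) + (x - 1) * ln (real n) = log_phi k x * ln (real n)"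
      by (simp add: log_phi_def algebra_simps)
    finally show ?case using elim by (simp add: powr_def)
  qed
  show "(\<lambda>n. real n powr log_phi k x) \<longlonglongrightarrow> 0"
    using neg by real_asymp
qed (auto)

end

section \<open>Convergence in probability\<close>

text \<open>
  The constants of the front, chosen in this order: the slope \<open>c\<close> and the block length \<open>r\<close> from
  \<open>block_exists\<close>; the cap \<open>\<theta>\<close> for which the capped slope is \<open>c\<close>; the near fraction \<open>\<theta>'\<close> that stays below
  the cap for \<open>r\<close> steps; finally \<open>s\<close>, so small that the errors neither stop the front nor prevent the
  collapse that starts from the far fraction \<open>1 - \<theta>'\<close>.
\<close>

lemma block_parameters:
  assumes k: "2 \<le> k" and x: "dag_sigma k < x" "x < 1"
  obtains c \<theta> \<theta>' s :: real and r :: nat where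
    "0 \<le> \<theta>" "c = real k / (1 + real k * \<theta>)" "0 < \<theta>'" "\<theta>' \<le> 1" "\<theta>' * (1 + c) ^ r \<le> \<theta>" "1 \<le> r"
    "2 \<le> c ^ r * exp (- (real r / x + 1)) * ((real r / x) ^ (r - 1) / fact (r - 1))"
    "0 < s" "s \<le> 1" "2 * s * (1 + c) ^ r \<le> \<theta>'"
    "0 < (1 + s)\<^sup>2 * (1 - \<theta>')" "(1 + s)\<^sup>2 * (1 - \<theta>') < 1"
proof -
  note \<sigma> = dag_sigma[OF k]
  have x0: "0 < x" using \<sigma> x by linarith
  have "0 < log_phi k x"
    using log_phi_strict_mono[of "real k" "dag_sigma k" x] \<sigma> x k by simp
  from block_exists[OF k x0 x(2) this] obtain c r where c: "0 < c" "c < real k" and r: "1 \<le> r"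
    "2 \<le> c ^ r * exp (- (real r / x + 1)) * ((real r / x) ^ (r - 1) / fact (r - 1))" by blast
  define \<theta> where "\<theta> = 1 / c - 1 / real k"
  define P where "P = (1 + c) ^ r"
  define \<theta>' where "\<theta>' = min (\<theta> / P) (1 / 2)"
  define s where "s = \<theta>' / (3 * P)"
  have P: "1 \<le> P" unfolding P_def using c by (intro one_le_power) auto
  have \<theta>: "0 < \<theta>" unfolding \<theta>_def using c by (simp add: divide_strict_left_mono)
  have c_eq: "c = real k / (1 + real k * \<theta>)" unfolding \<theta>_def using c k by (simp add: right_diff_distrib)
  have \<theta>': "0 < \<theta>'" "\<theta>' \<le> 1 / 2"
    unfolding \<theta>'_def using \<theta> P by (auto simp only: min.cobounded2) (simp add: min_def)
  have "\<theta>' \<le> \<theta> / P" unfolding \<theta>'_def by simp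
  then have \<theta>'P: "\<theta>' * P \<le> \<theta>" using P by (simp add: pos_le_divide_eq)
  have "0 < s" unfolding s_def using \<theta>' P by simp
  moreover have "s \<le> \<theta>' / 3" unfolding s_def using \<theta>' P by (intro divide_left_mono) simp_all
  ultimately have s: "0 < s" "s \<le> \<theta>' / 3" .
  have sP: "2 * s * P \<le> \<theta>'" unfolding s_def using \<theta>' P by simp
  have "s * s \<le> s * 1" using s \<theta>' by (intro mult_left_mono) auto
  moreover have "(1 + s)\<^sup>2 = 1 + 2 * s + s * s" by (simp add: power2_eq_square algebra_simps)
  ultimately have "(1 + s)\<^sup>2 \<le> 1 + \<theta>'" using s by linarith
  then have "(1 + s)\<^sup>2 * (1 - \<theta>') \<le> (1 + \<theta>') * (1 - \<theta>')"
    using \<theta>' by (intro mult_right_mono) auto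
  also have "\<dots> = 1 - \<theta>' * \<theta>'" by (simp add: algebra_simps)
  also have "\<dots> < 1" using \<theta>' by simp
  finally have \<rho>: "(1 + s)\<^sup>2 * (1 - \<theta>') < 1" .
  have \<rho>0: "0 < (1 + s)\<^sup>2 * (1 - \<theta>')" using s \<theta>' by (intro mult_pos_pos) auto
  show ?thesis
    by (rule that[of \<theta> c \<theta>' r s])
      (use \<theta> c_eq \<theta>' \<theta>'P r s sP \<rho> \<rho>0 in \<open>simp_all add: P_def\<close>)
qed

context uniform_random_dag
begin

lemma event_exists_far: "{\<omega> \<in> space M. \<exists>l\<le>n. \<not> near k (parents \<omega>) t l} \<in> events"
proof -
  have "{\<omega> \<in> space M. \<exists>l\<le>n. \<not> near k (parents \<omega>) t l}
      = (\<Union>l\<in>{..n}. {\<omega> \<in> space M. \<not> near k (parents \<omega>) t l})"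
    by (auto simp del: near.simps)
  also have "\<dots> \<in> events" by (rule sets.finite_UN) (simp_all only: finite_atMost event_near[of Not])
  finally show ?thesis .
qed

text \<open>
  For \<open>\<sigma> < x < y\<close> the time needed is \<open>x ln n\<close> for the front, plus at most \<open>7 h ln n\<close> for the initial
  range and the collapse, plus a constant; \<open>h\<close> is chosen such that half of \<open>(y - x) ln n\<close> remains.
\<close>

lemma far_late_tendsto_0:
  assumes k: "2 \<le> k" and y: "dag_sigma k < y"
  shows "(\<lambda>n. prob {\<omega> \<in> space M. \<exists>l\<le>n. \<not> near k (parents \<omega>) (nat \<lfloor>y * ln (real n)\<rfloor>) l}) \<longlonglongrightarrow> 0"
proof -
  note \<sigma> = dag_sigma[OF k]
  define x where "x = (dag_sigma k + min y 1) / 2"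
  have x: "dag_sigma k < x" "x < 1" "x < y" "0 < x" using y \<sigma> by (auto simp: x_def min_def)
  define h where "h = (y - x) / 14"
  have h: "0 < h" using x by (simp add: h_def)
  obtain c \<theta> \<theta>' s :: real and r :: nat where
    \<theta>: "0 \<le> \<theta>" and c: "c = real k / (1 + real k * \<theta>)" and \<theta>': "0 < \<theta>'" "\<theta>' \<le> 1" "\<theta>' * (1 + c) ^ r \<le> \<theta>"
    and r: "1 \<le> r" "2 \<le> c ^ r * exp (- (real r / x + 1)) * ((real r / x) ^ (r - 1) / fact (r - 1))"
    and s: "0 < s" "s \<le> 1" "2 * s * (1 + c) ^ r \<le> \<theta>'"
    and \<rho>: "0 < (1 + s)\<^sup>2 * (1 - \<theta>')" "(1 + s)\<^sup>2 * (1 - \<theta>') < 1"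
    using block_parameters[OF k x(1,2)] by metis
  define \<rho> where "\<rho> = (1 + s)\<^sup>2 * (1 - \<theta>')"
  define b where "b = real r / x"
  define \<kappa> where "\<kappa> = - ln \<rho>"
  have b: "0 < b" using r x by (simp add: b_def)
  have \<rho>1: "0 < \<rho>" "\<rho> < 1" using \<rho> unfolding \<rho>_def by auto
  then have \<kappa>: "0 < \<kappa>" unfolding \<kappa>_def using ln_less_zero[of \<rho>] by simp
  have \<rho>_exp: "\<rho> = exp (- \<kappa>)" using \<rho>1 by (simp add: \<kappa>_def)
  define B where "B n = 3 * ln (real n) / s" for n :: nat
  define m where "m n = nat \<lfloor>real n powr h\<rfloor>" for n :: nat
  define t0 where "t0 n = nat \<lceil>6 * h * ln (real n)\<rceil>" for n :: nat
  define q where "q n = nat \<lceil>ln (real n) / (b + 1)\<rceil>" for n :: nat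
  define J where "J n = nat \<lfloor>h * ln (real n)\<rfloor>" for n :: nat
  define t where "t n = t0 n + r * q n + J n" for n
  define a where "a n = exp (- \<kappa> * 2 powr (h * ln (real n) - 1))" for n :: nat
  \<comment> \<open>the sum of the bounds for the three kinds of failure;
    a bounds the constant part of the far fraction after the collapse\<close>
  define g where "g n = (real n powr h + 1)\<^sup>2 / real n powr (4 * h) + 1 / real n
    + (2 * real n * a n + 8 * (B n)\<^sup>2 / (real n powr h - 1))" for n :: nat
  have "eventually (\<lambda>n. real r * exp (b + 1) \<le> real n powr h - 1) at_top"
    using h by real_asymp
  moreover have "eventually (\<lambda>n. 1 \<le> real n powr h - 1) at_top"
    using h by real_asymp
  moreover have "eventually (\<lambda>n. 4 * B n * (1 + s) * (1 + 1 / s) \<le> real n powr h - 1) at_top"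
    unfolding B_def using h s by real_asymp
  moreover have "eventually (\<lambda>n. B n * exp (b + 1) \<le> s * (real n powr h - 1)) at_top"
    unfolding B_def using h s by real_asymp
  moreover have "eventually (\<lambda>n. 4 * B n \<le> real n powr h - 1) at_top"
    unfolding B_def using h s by real_asymp
  moreover have "eventually (\<lambda>n. y * ln (real n) < real n) at_top"
    by real_asymp
  moreover have "eventually (\<lambda>n. real r + 4 \<le> 7 * h * ln (real n)) at_top"
    using h by real_asymp
  moreover have "eventually (\<lambda>n. a n \<le> 1 / 2) at_top"
    unfolding a_def using h \<kappa> by real_asymp
  moreover have "eventually (\<lambda>n. 1 \<le> n) (at_top :: nat filter)" by (rule eventually_ge_at_top)
  ultimately have le: "eventually (\<lambda>n. prob {\<omega> \<in> space M. \<exists>l\<le>n. \<not> near k (parents \<omega>) (nat \<lfloor>y * ln (real n)\<rfloor>) l} \<le> g n) at_top"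
  proof eventually_elim
    case (elim n)
    let ?L = "ln (real n)"
    have L: "0 \<le> ?L" using elim(9) by simp
    have B0: "0 \<le> B n" unfolding B_def using L s by simp
    have m_le: "real (m n) \<le> real n powr h" unfolding m_def by simp
    have m_ge: "real n powr h - 1 \<le> real (m n)" unfolding m_def by linarith
    have m1: "1 \<le> m n" using elim(2) m_ge by linarith
    have t0: "6 * h * ?L \<le> real (t0 n)" "real (t0 n) \<le> 6 * h * ?L + 1"
      unfolding t0_def using h L mult_nonneg_nonneg[of "6 * h" ?L] by linarith+
    have J: "h * ?L - 1 \<le> real (J n)" "real (J n) \<le> h * ?L"
      unfolding J_def using h L mult_nonneg_nonneg[of h ?L] by linarith+
    have q: "?L / (b + 1) \<le> real (q n)" "real (q n) \<le> ?L / (b + 1) + 1"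
      unfolding q_def using b L divide_nonneg_pos[of ?L "b + 1"] by linarith+
    have "?L / (b + 1) \<le> ?L / b" using b L by (intro divide_left_mono) auto
    then have "real r * real (q n) \<le> real r * (?L / b + 1)" using q(2) by (intro mult_left_mono) auto
    also have "real r * (?L / b + 1) = x * ?L + real r" using r x by (simp add: b_def distrib_left)
    finally have rq: "real r * real (q n) \<le> x * ?L + real r" .
    have "real (t n) \<le> 7 * h * ?L + x * ?L + real r + 1"
      unfolding t_def using t0(2) J(2) rq by (simp add: algebra_simps)
    also have "7 * h * ?L + x * ?L = y * ?L - 7 * h * ?L" by (simp add: h_def algebra_simps)
    finally have t_le: "real (t n) + 3 \<le> y * ?L" using elim(7) by linarith
    then have tT: "Suc (t n) \<le> nat \<lfloor>y * ?L\<rfloor>" by linarith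
    have tn: "t n < n" using t_le elim(6) by linarith
    have nq: "real n \<le> real (m n) * exp (b + 1) ^ q n"
    proof -
      have "?L \<le> real (q n) * (b + 1)" using q(1) b by (simp add: pos_divide_le_eq)
      then have "exp ?L \<le> exp (b + 1) ^ q n" by (simp flip: exp_of_nat_mult)
      moreover have "1 * exp (b + 1) ^ q n \<le> real (m n) * exp (b + 1) ^ q n"
        using m1 by (intro mult_right_mono) auto
      moreover have "exp ?L = real n" using elim(9) by simp
      ultimately show ?thesis by linarith
    qed
    define \<alpha> where "\<alpha> = \<rho> ^ 2 ^ J n / (1 + s)\<^sup>2"
    have \<alpha>: "0 \<le> \<alpha>" "\<alpha> \<le> a n"
    proof -
      show "0 \<le> \<alpha>" unfolding \<alpha>_def using \<rho>1 by simp
      have "1 \<le> (1 + s)\<^sup>2" using s by (intro one_le_power) simp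
      then have "\<rho> ^ 2 ^ J n / (1 + s)\<^sup>2 \<le> \<rho> ^ 2 ^ J n / 1"
        using \<rho>1 by (intro divide_left_mono) auto
      also have "\<dots> = exp (real (2 ^ J n) * - \<kappa>)" unfolding \<rho>_exp by (simp only: exp_of_nat_mult div_by_1)
      also have "\<dots> \<le> a n"
      proof -
        have "2 powr (h * ?L - 1) \<le> 2 powr real (J n)" using J(1) by (intro powr_mono) auto
        also have "\<dots> = real (2 ^ J n)" by (simp add: powr_realpow)
        finally show ?thesis unfolding a_def using \<kappa> by (simp add: mult.commute)
      qed
      finally show "\<alpha> \<le> a n" unfolding \<alpha>_def .
    qed
    have p: "prob {\<omega> \<in> space M. \<exists>l\<le>n. \<not> near k (parents \<omega>) (Suc (t n)) l}
        \<le> (real (m n) + 1)\<^sup>2 / 2 ^ t0 n + 1 / real n + (2 * real n * \<alpha>\<^sup>2 + 8 * (B n)\<^sup>2 / real (m n))"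
    proof (rule prob_exists_far_le[where \<theta> = \<theta> and \<theta>' = \<theta>' and c = c and r = r and b = b and s = s and q = "q n" and J = "J n" and \<rho> = \<rho>])
      show "2 \<le> c ^ r * exp (- (b + 1)) * (b ^ (r - 1) / fact (r - 1))" using r(2) unfolding b_def .
      show "real r * exp (b + 1) \<le> real (m n)" "4 * B n * (1 + s) * (1 + 1 / s) \<le> real (m n)"
        using elim(1,3) m_ge by linarith+
      have "B n * exp (b + 1) \<le> s * real (m n)"
        using elim(4) mult_left_mono[OF m_ge, of s] s by linarith
      then show "B n / real (m n) * exp (b + 1) \<le> s" using m1 by (simp add: pos_divide_le_eq)
      show "2 * B n / real (m n) \<le> 1 / 2" using elim(5) m_ge m1 by (simp add: pos_divide_le_eq)
      show "\<rho> ^ 2 ^ J n / (1 + s)\<^sup>2 = \<alpha>" by (simp add: \<alpha>_def)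
      show "\<alpha> \<le> 1 / 2" using \<alpha> elim(8) by linarith
      show "B n = 3 * ln (real n) / s" by (simp add: B_def)
      show "\<rho> = (1 + s)\<^sup>2 * (1 - \<theta>')" by (simp add: \<rho>_def)
      show "t n = t0 n + r * q n + J n" by (simp add: t_def)
      show "0 \<le> \<theta>'" using \<theta>'(1) by simp
    qed (fact k \<theta> c \<theta>' r(1) b s elim(9) m1 nq tn)+
    have sub: "{\<omega> \<in> space M. \<exists>l\<le>n. \<not> near k (parents \<omega>) (nat \<lfloor>y * ?L\<rfloor>) l}
        \<subseteq> {\<omega> \<in> space M. \<exists>l\<le>n. \<not> near k (parents \<omega>) (Suc (t n)) l}"
    proof
      fix \<omega> assume "\<omega> \<in> {\<omega> \<in> space M. \<exists>l\<le>n. \<not> near k (parents \<omega>) (nat \<lfloor>y * ?L\<rfloor>) l}"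
      then obtain l where "\<omega> \<in> space M" "l \<le> n" "\<not> near k (parents \<omega>) (nat \<lfloor>y * ?L\<rfloor>) l"
        by (auto simp del: near.simps)
      with near_mono[OF tT, of k "parents \<omega>" l]
      show "\<omega> \<in> {\<omega> \<in> space M. \<exists>l\<le>n. \<not> near k (parents \<omega>) (Suc (t n)) l}"
        by (auto simp del: near.simps)
    qed
    \<comment> \<open>the factor 6 in t0 ensures 2 ^ t0 \<ge> n powr (4 h), which beats the square of the initial range\<close>
    have "2 powr (6 * h * ?L) \<le> 2 powr real (t0 n)" using t0(1) by (intro powr_mono) auto
    then have "2 powr (6 * h * ?L) \<le> 2 ^ t0 n" by (simp add: powr_realpow)
    moreover have "real n powr (4 * h) \<le> 2 powr (6 * h * ?L)"
    proof -
      have "6 * h * ?L * (2 / 3) \<le> 6 * h * ?L * ln 2"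
        using h L ln2_ge_two_thirds by (intro mult_left_mono) auto
      then show ?thesis using elim(9) by (simp add: powr_def)
    qed
    ultimately have "(real (m n) + 1)\<^sup>2 / 2 ^ t0 n \<le> (real n powr h + 1)\<^sup>2 / real n powr (4 * h)"
      using m_le elim(9) by (intro frac_le power_mono) auto
    moreover have "2 * real n * \<alpha>\<^sup>2 \<le> 2 * real n * a n"
    proof (rule mult_left_mono)
      have "\<alpha> * \<alpha> \<le> \<alpha> * 1" using \<alpha> elim(8) by (intro mult_left_mono) auto
      then show "\<alpha>\<^sup>2 \<le> a n" using \<alpha> by (simp add: power2_eq_square)
    qed simp
    moreover have "8 * (B n)\<^sup>2 / real (m n) \<le> 8 * (B n)\<^sup>2 / (real n powr h - 1)"
      using m_ge elim(2) by (intro divide_left_mono) auto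
    moreover have "prob {\<omega> \<in> space M. \<exists>l\<le>n. \<not> near k (parents \<omega>) (nat \<lfloor>y * ?L\<rfloor>) l}
        \<le> prob {\<omega> \<in> space M. \<exists>l\<le>n. \<not> near k (parents \<omega>) (Suc (t n)) l}"
      by (rule finite_measure_mono[OF sub event_exists_far])
    ultimately show ?case unfolding g_def using p by linarith
  qed
  have g: "g \<longlonglongrightarrow> 0"
  proof -
    have l1: "(\<lambda>n. (real n powr h + 1)\<^sup>2 / real n powr (4 * h)) \<longlonglongrightarrow> 0"
      using h by real_asymp
    have l2: "(\<lambda>n. 1 / real n) \<longlonglongrightarrow> 0" by real_asymp
    have l3: "(\<lambda>n. 2 * real n * a n) \<longlonglongrightarrow> 0"
      unfolding a_def using h \<kappa> by real_asymp
    have l4: "(\<lambda>n. 8 * (B n)\<^sup>2 / (real n powr h - 1)) \<longlonglongrightarrow> 0"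
      unfolding B_def using h s(1) by real_asymp
    from tendsto_add[OF tendsto_add[OF l1 l2] tendsto_add[OF l3 l4]]
    show ?thesis unfolding g_def by simp
  qed
  show ?thesis
    by (rule tendsto_sandwich[OF _ le tendsto_const g]) simp
qed

lemma near_early_and_far_late_tendsto_0:
  assumes k: "2 \<le> k" and x: "0 < x" "x < dag_sigma k" and y: "dag_sigma k < y"
  shows "(\<lambda>n. prob ({\<omega> \<in> space M. near k (parents \<omega>) (nat \<lfloor>x * ln (real n)\<rfloor>) n}
    \<union> {\<omega> \<in> space M. \<exists>l\<le>n. \<not> near k (parents \<omega>) (nat \<lfloor>y * ln (real n)\<rfloor>) l})) \<longlonglongrightarrow> 0"
proof (rule tendsto_sandwich)
  show "(\<lambda>_. 0 :: real) \<longlonglongrightarrow> 0" by simp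
  show "(\<lambda>n. prob {\<omega> \<in> space M. near k (parents \<omega>) (nat \<lfloor>x * ln (real n)\<rfloor>) n}
    + prob {\<omega> \<in> space M. \<exists>l\<le>n. \<not> near k (parents \<omega>) (nat \<lfloor>y * ln (real n)\<rfloor>) l}) \<longlonglongrightarrow> 0"
    using tendsto_add[OF near_early_tendsto_0[OF k x] far_late_tendsto_0[OF k y]] by simp
  show "eventually (\<lambda>n. prob ({\<omega> \<in> space M. near k (parents \<omega>) (nat \<lfloor>x * ln (real n)\<rfloor>) n}
    \<union> {\<omega> \<in> space M. \<exists>l\<le>n. \<not> near k (parents \<omega>) (nat \<lfloor>y * ln (real n)\<rfloor>) l})
    \<le> prob {\<omega> \<in> space M. near k (parents \<omega>) (nat \<lfloor>x * ln (real n)\<rfloor>) n}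
    + prob {\<omega> \<in> space M. \<exists>l\<le>n. \<not> near k (parents \<omega>) (nat \<lfloor>y * ln (real n)\<rfloor>) l}) at_top"
    by (intro always_eventually allI measure_Un_le event_near[of "\<lambda>b. b"] event_exists_far)
qed auto

text \<open>
  Both claims at once: the lower bound is needed at \<open>n\<close> only, because \<open>V n\<close> is at least \<open>S n\<close>, and the
  upper bound holds for all nodes up to \<open>n\<close> simultaneously.
\<close>

lemma tendsto_in_probability_between:
  fixes V :: "nat \<Rightarrow> 'w \<Rightarrow> nat"
  assumes k: "2 \<le> k"
    and meas: "\<And>n. (\<lambda>\<omega>. real (V n \<omega>) / ln (real n)) \<in> borel_measurable M"
    and lower: "\<And>n \<omega>. 1 \<le> n \<Longrightarrow> \<omega> \<in> space M \<Longrightarrow> S n \<omega> \<le> V n \<omega>"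
    and upper: "\<And>n \<omega>. 1 \<le> n \<Longrightarrow> \<omega> \<in> space M \<Longrightarrow> \<exists>l\<le>n. V n \<omega> \<le> S l \<omega>"
  shows "tendsto_in_probability M (\<lambda>n \<omega>. real (V n \<omega>) / ln (real n)) (dag_sigma k)"
  unfolding tendsto_in_probability_def
proof (intro conjI allI impI meas)
  fix \<epsilon> :: real assume \<epsilon>: "0 < \<epsilon>"
  note \<sigma> = dag_sigma[OF k]
  \<comment> \<open>the maximum keeps x positive when \<epsilon> exceeds \<sigma>\<close>
  define x where "x = max (dag_sigma k - \<epsilon>) (dag_sigma k / 2)"
  define y where "y = dag_sigma k + \<epsilon>"
  have x: "0 < x" "x < dag_sigma k" using \<epsilon> \<sigma> by (auto simp: x_def)
  have y: "dag_sigma k < y" using \<epsilon> by (simp add: y_def)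
  let ?E = "\<lambda>n. {\<omega> \<in> space M. \<epsilon> < \<bar>real (V n \<omega>) / ln (real n) - dag_sigma k\<bar>}"
  let ?N = "\<lambda>n. {\<omega> \<in> space M. near k (parents \<omega>) (nat \<lfloor>x * ln (real n)\<rfloor>) n}"
  let ?F = "\<lambda>n. {\<omega> \<in> space M. \<exists>l\<le>n. \<not> near k (parents \<omega>) (nat \<lfloor>y * ln (real n)\<rfloor>) l}"
  have sub: "?E n \<subseteq> ?N n \<union> ?F n" if n: "2 \<le> n" for n
  proof
    fix \<omega> assume "\<omega> \<in> ?E n"
    then have \<omega>: "\<omega> \<in> space M" and dev: "\<epsilon> < \<bar>real (V n \<omega>) / ln (real n) - dag_sigma k\<bar>" by auto
    have L: "0 < ln (real n)" using n by simp
    have S_iff: "S l \<omega> \<le> u \<longleftrightarrow> near k (parents \<omega>) u l" for l u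
      using k \<omega> by (intro S_le_iff) auto
    consider "real (V n \<omega>) / ln (real n) < dag_sigma k - \<epsilon>" | "y < real (V n \<omega>) / ln (real n)"
      using dev unfolding y_def by linarith
    then show "\<omega> \<in> ?N n \<union> ?F n"
    proof cases
      case 1
      then have "real (V n \<omega>) / ln (real n) < x" by (simp add: x_def)
      then have "real (V n \<omega>) < x * ln (real n)" using L by (simp add: pos_divide_less_eq)
      then have "S n \<omega> \<le> nat \<lfloor>x * ln (real n)\<rfloor>" using lower[OF _ \<omega>, of n] n by linarith
      then show ?thesis using \<omega> unfolding S_iff by (simp del: near.simps)
    next
      case 2
      then have "y * ln (real n) < real (V n \<omega>)" using L by (simp add: pos_less_divide_eq)
      moreover obtain l where l: "l \<le> n" "V n \<omega> \<le> S l \<omega>" using upper[OF _ \<omega>, of n] n by auto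
      moreover have "0 \<le> y * ln (real n)" using y \<sigma> L by simp
      ultimately have "\<not> S l \<omega> \<le> nat \<lfloor>y * ln (real n)\<rfloor>" by linarith
      then have "\<omega> \<in> ?F n" using \<omega> l(1) unfolding S_iff by (auto simp del: near.simps)
      then show ?thesis by simp
    qed
  qed
  have le: "eventually (\<lambda>n. prob (?E n) \<le> prob (?N n \<union> ?F n)) at_top"
    using eventually_ge_at_top[of 2]
  proof eventually_elim
    case (elim n)
    show ?case
      by (rule finite_measure_mono[OF sub[OF elim]])
        (rule sets.Un[OF event_near[of "\<lambda>b. b"] event_exists_far])
  qed
  show "(\<lambda>n. prob (?E n)) \<longlonglongrightarrow> 0"
    by (rule tendsto_sandwich[OF _ le tendsto_const near_early_and_far_late_tendsto_0[OF k x y]]) simp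
qed

end

theorem theorem2:
  fixes M :: "'w measure" and k :: nat and parent :: "nat \<times> nat \<Rightarrow> 'w \<Rightarrow> nat"
  assumes "uniform_random_dag M k parent"
    and "k \<ge> 2"
  shows "strict_mono_on {0<..<1} (dag_phi k) \<and>
    (\<exists>!x. x \<in> {0<..<1} \<and> dag_phi k x = 1) \<and>
    tendsto_in_probability M
      (\<lambda>n \<omega>. real (uniform_random_dag.S k parent n \<omega>) / ln (real n)) (dag_sigma k) \<and>
    tendsto_in_probability M
      (\<lambda>n \<omega>. real (MAX l\<in>{1..n}. uniform_random_dag.S k parent l \<omega>) / ln (real n))
      (dag_sigma k)"
proof -
  interpret uniform_random_dag M k parent by (rule assms(1))
  have k0: "0 < k" using assms(2) by simp
  have single: "tendsto_in_probability M (\<lambda>n \<omega>. real (S n \<omega>) / ln (real n)) (dag_sigma k)"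
    by (rule tendsto_in_probability_between[OF assms(2) borel_measurable_S[OF k0]]) auto
  have max: "tendsto_in_probability M
      (\<lambda>n \<omega>. real (MAX l\<in>{1..n}. S l \<omega>) / ln (real n)) (dag_sigma k)"
  proof (rule tendsto_in_probability_between[OF assms(2) borel_measurable_Max_S[OF k0]])
    fix n \<omega> assume n: "(1::nat) \<le> n"
    show "S n \<omega> \<le> (MAX l\<in>{1..n}. S l \<omega>)" using n by (intro Max_ge) auto
    have "(MAX l\<in>{1..n}. S l \<omega>) \<in> (\<lambda>l. S l \<omega>) ` {1..n}" using n by (intro Max_in) auto
    then show "\<exists>l\<le>n. (MAX l\<in>{1..n}. S l \<omega>) \<le> S l \<omega>" by auto
  qed
  show ?thesis
    using strict_mono_on_dag_phi[OF assms(2)] dag_phi_root[OF assms(2)] single max by (intro conjI)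
qed

end
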